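(* Let $X$ be a Martin-Löf random sequence. If a formula $\phi$ is provable in $\mathsf{MLR}_c(X)$ for every $c$, then $\phi$ is provable in $\mathsf{PA}$.
   Context: $\mathsf{PA}$ is Peano arithmetic. $\mathrm{K}$ denotes prefix Kolmogorov complexity, represented in $\mathsf{PA}$ in a natural way so that its standard properties (including those used in the Levin–Schnorr theorem) are provable in $\mathsf{PA}$. For an infinite binary sequence $X$, $X\upharpoonright n$ is its prefix of length $n$. For a natural number $c$, $\mathsf{MLR}_c(X)$ is the theory $\mathsf{PA}$ plus the axioms "$\mathrm{K}(X\upharpoonright n)\ge n-c$" for all $n$ (with $X\upharpoonright n$ given as a numeral). *)

theory Defs
  imports "HOL-Probability.Probability" "HOL-Library.Sublist" "HOL-Number_Theory.Cong"
begin

section \<open>First-order arithmetic\<close>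

text \<open>Variables are de Bruijn indices; substitution is parallel.\<close>

datatype tm = Var nat | Zero | Succ tm | Add tm tm | Mul tm tm

datatype fm = Fls | Eq tm tm | Imp fm fm | All fm

abbreviation Neg :: "fm \<Rightarrow> fm" where "Neg A \<equiv> Imp A Fls"
abbreviation And :: "fm \<Rightarrow> fm \<Rightarrow> fm" where "And A B \<equiv> Neg (Imp A (Neg B))"
abbreviation Ex :: "fm \<Rightarrow> fm" where "Ex A \<equiv> Neg (All (Neg A))"

primrec fv_tm :: "tm \<Rightarrow> nat set" where
  "fv_tm (Var i) = {i}"
| "fv_tm Zero = {}"
| "fv_tm (Succ s) = fv_tm s"
| "fv_tm (Add s t) = fv_tm s \<union> fv_tm t"
| "fv_tm (Mul s t) = fv_tm s \<union> fv_tm t"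

primrec fv :: "fm \<Rightarrow> nat set" where
  "fv Fls = {}"
| "fv (Eq s t) = fv_tm s \<union> fv_tm t"
| "fv (Imp A B) = fv A \<union> fv B"
| "fv (All A) = {i. Suc i \<in> fv A}"

primrec subst_tm :: "(nat \<Rightarrow> tm) \<Rightarrow> tm \<Rightarrow> tm" where
  "subst_tm \<sigma> (Var i) = \<sigma> i"
| "subst_tm \<sigma> Zero = Zero"
| "subst_tm \<sigma> (Succ s) = Succ (subst_tm \<sigma> s)"
| "subst_tm \<sigma> (Add s t) = Add (subst_tm \<sigma> s) (subst_tm \<sigma> t)"
| "subst_tm \<sigma> (Mul s t) = Mul (subst_tm \<sigma> s) (subst_tm \<sigma> t)"

definition lift :: "tm \<Rightarrow> tm" where
  "lift t = subst_tm (\<lambda>i. Var (Suc i)) t"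

definition up :: "(nat \<Rightarrow> tm) \<Rightarrow> nat \<Rightarrow> tm" where
  "up \<sigma> = case_nat (Var 0) (\<lambda>i. lift (\<sigma> i))"

primrec subst_fm :: "(nat \<Rightarrow> tm) \<Rightarrow> fm \<Rightarrow> fm" where
  "subst_fm \<sigma> Fls = Fls"
| "subst_fm \<sigma> (Eq s t) = Eq (subst_tm \<sigma> s) (subst_tm \<sigma> t)"
| "subst_fm \<sigma> (Imp A B) = Imp (subst_fm \<sigma> A) (subst_fm \<sigma> B)"
| "subst_fm \<sigma> (All A) = All (subst_fm (up \<sigma>) A)"

definition lift_fm :: "fm \<Rightarrow> fm" where
  "lift_fm A = subst_fm (\<lambda>i. Var (Suc i)) A"

definition inst :: "fm \<Rightarrow> tm \<Rightarrow> fm" where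
  "inst A t = subst_fm (case_nat t Var) A"

definition inst2 :: "fm \<Rightarrow> tm \<Rightarrow> tm \<Rightarrow> fm" where
  "inst2 A s t = subst_fm (case_nat s (case_nat t Var)) A"

primrec numeral_tm :: "nat \<Rightarrow> tm" where
  "numeral_tm 0 = Zero"
| "numeral_tm (Suc n) = Succ (numeral_tm n)"

subsection \<open>The standard model\<close>

primrec eval_tm :: "(nat \<Rightarrow> nat) \<Rightarrow> tm \<Rightarrow> nat" where
  "eval_tm e (Var i) = e i"
| "eval_tm e Zero = 0"
| "eval_tm e (Succ s) = Suc (eval_tm e s)"
| "eval_tm e (Add s t) = eval_tm e s + eval_tm e t"
| "eval_tm e (Mul s t) = eval_tm e s * eval_tm e t"

primrec sat :: "(nat \<Rightarrow> nat) \<Rightarrow> fm \<Rightarrow> bool" where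
  "sat e Fls \<longleftrightarrow> False"
| "sat e (Eq s t) \<longleftrightarrow> eval_tm e s = eval_tm e t"
| "sat e (Imp A B) \<longleftrightarrow> (sat e A \<longrightarrow> sat e B)"
| "sat e (All A) \<longleftrightarrow> (\<forall>n. sat (case_nat n e) A)"

subsection \<open>Provability and Peano arithmetic\<close>

text \<open>
  Hilbert calculus for classical first-order logic with equality. Since \<open>Gen\<close> also applies to
  consequences of \<open>T\<close>, an open formula in \<open>T\<close> acts as its universal closure.
\<close>

inductive proves :: "fm set \<Rightarrow> fm \<Rightarrow> bool" (infix \<open>\<turnstile>\<close> 50) for T :: "fm set" where
  Ax: "A \<in> T \<Longrightarrow> T \<turnstile> A"
| K: "T \<turnstile> Imp A (Imp B A)"
| S: "T \<turnstile> Imp (Imp A (Imp B C)) (Imp (Imp A B) (Imp A C))"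
| DN: "T \<turnstile> Imp (Neg (Neg A)) A"
| Inst: "T \<turnstile> Imp (All A) (inst A t)"
| Dist: "T \<turnstile> Imp (All (Imp A B)) (Imp (All A) (All B))"
| Vac: "T \<turnstile> Imp A (All (lift_fm A))"
| Refl: "T \<turnstile> Eq t t"
| Leib: "T \<turnstile> Imp (Eq s t) (Imp (inst A s) (inst A t))"
| MP: "T \<turnstile> Imp A B \<Longrightarrow> T \<turnstile> A \<Longrightarrow> T \<turnstile> B"
| Gen: "T \<turnstile> A \<Longrightarrow> T \<turnstile> All A"

definition induction_ax :: "fm \<Rightarrow> fm" where
  "induction_ax A =
     Imp (inst A Zero)
      (Imp (All (Imp A (subst_fm (case_nat (Succ (Var 0)) (\<lambda>i. Var (Suc i))) A)))
        (All A))"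

definition PA :: "fm set" where
  "PA =
    {All (Neg (Eq (Succ (Var 0)) Zero)),
     All (All (Imp (Eq (Succ (Var 0)) (Succ (Var 1))) (Eq (Var 0) (Var 1)))),
     All (Eq (Add (Var 0) Zero) (Var 0)),
     All (All (Eq (Add (Var 0) (Succ (Var 1))) (Succ (Add (Var 0) (Var 1))))),
     All (Eq (Mul (Var 0) Zero) Zero),
     All (All (Eq (Mul (Var 0) (Succ (Var 1))) (Add (Mul (Var 0) (Var 1)) (Var 0))))}
    \<union> range induction_ax"

subsection \<open>Arithmetical formulas used to speak about strings\<close>

definition le_fm :: "tm \<Rightarrow> tm \<Rightarrow> fm" where
  "le_fm s t = Ex (Eq (Add (lift s) (Var 0)) (lift t))"

definition lt_fm :: "tm \<Rightarrow> tm \<Rightarrow> fm" where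
  "lt_fm s t = le_fm (Succ s) t"

text \<open>Goedel's beta function: \<open>y = a mod (1 + (i + 1) b)\<close>.\<close>

definition beta_fm :: "tm \<Rightarrow> tm \<Rightarrow> tm \<Rightarrow> tm \<Rightarrow> fm" where
  "beta_fm a b i y =
     And (lt_fm y (Succ (Mul (Succ i) b)))
       (Ex (Eq (lift a) (Add (Mul (Var 0) (lift (Succ (Mul (Succ i) b)))) (lift y))))"

text \<open>\<open>y = 2 ^ m\<close>: some sequence starts with 1, doubles at each step, and has \<open>y\<close> at position \<open>m\<close>.\<close>

definition pow2_fm :: "tm \<Rightarrow> tm \<Rightarrow> fm" where
  "pow2_fm m y =
     Ex (Ex (And (beta_fm (Var 1) (Var 0) Zero (Succ Zero))
       (And (All (Imp (lt_fm (Var 0) (lift (lift (lift m))))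
               (Ex (And (beta_fm (Var 3) (Var 2) (Var 1) (Var 0))
                        (beta_fm (Var 3) (Var 2) (Succ (Var 1)) (Add (Var 0) (Var 0)))))))
            (beta_fm (Var 1) (Var 0) (lift (lift m)) (lift (lift y))))))"

text \<open>
  Numbers code binary strings bijectively: \<open>n\<close> codes \<open>s\<close> iff \<open>1s\<close> is the binary expansion of
  \<open>n + 1\<close>. Hence \<open>s\<close> has length \<open>l\<close> iff \<open>2 ^ l \<le> n + 1 < 2 ^ (l + 1)\<close>, and \<open>p\<close> codes a prefix of
  what \<open>q\<close> codes iff \<open>q + 1 = (p + 1) * 2 ^ m + r\<close> for some \<open>m\<close> and \<open>r < 2 ^ m\<close>.
\<close>

definition code :: "bool list \<Rightarrow> nat" where
  "code s = foldl (\<lambda>n b. 2 * n + 1 + of_bool b) 0 s"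

definition len_fm :: "tm \<Rightarrow> tm \<Rightarrow> fm" where
  "len_fm p l =
     Ex (And (pow2_fm (lift l) (Var 0))
       (And (le_fm (Var 0) (Succ (lift p)))
            (lt_fm (Succ (lift p)) (Add (Var 0) (Var 0)))))"

definition prefix_fm :: "tm \<Rightarrow> tm \<Rightarrow> fm" where
  "prefix_fm p q =
     Ex (Ex (Ex (And (pow2_fm (Var 2) (Var 1))
       (And (lt_fm (Var 0) (Var 1))
            (Eq (Succ (lift (lift (lift q))))
                (Add (Mul (Succ (lift (lift (lift p)))) (Var 1)) (Var 0)))))))"

subsection \<open>\<open>\<Sigma>\<^sub>1\<close> formulas\<close>

inductive delta0 :: "fm \<Rightarrow> bool" where
  "delta0 Fls"
| "delta0 (Eq s t)"
| "delta0 A \<Longrightarrow> delta0 B \<Longrightarrow> delta0 (Imp A B)"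
| "delta0 A \<Longrightarrow> delta0 (All (Imp (lt_fm (Var 0) (lift t)) A))"

inductive sigma1 :: "fm \<Rightarrow> bool" where
  "delta0 A \<Longrightarrow> sigma1 A"
| "sigma1 A \<Longrightarrow> sigma1 (Ex A)"

section \<open>Partial recursive functions\<close>

datatype recf =
  RZero | RSucc | RProj nat | RComp recf "recf list" | RPrim recf recf | RMu recf

text \<open>\<open>computes f xs y\<close>: the partial recursive function with index \<open>f\<close> has value \<open>y\<close> at \<open>xs\<close>.\<close>

inductive computes :: "recf \<Rightarrow> nat list \<Rightarrow> nat \<Rightarrow> bool" where
  "computes RZero xs 0"
| "computes RSucc [x] (Suc x)"
| "i < length xs \<Longrightarrow> computes (RProj i) xs (xs ! i)"
| "list_all2 (\<lambda>g y. computes g xs y) gs ys \<Longrightarrow> computes f ys z \<Longrightarrow> computes (RComp f gs) xs z"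
| "computes f xs y \<Longrightarrow> computes (RPrim f g) (0 # xs) y"
| "computes (RPrim f g) (n # xs) y \<Longrightarrow> computes g (n # y # xs) z \<Longrightarrow>
     computes (RPrim f g) (Suc n # xs) z"
| "computes f (n # xs) 0 \<Longrightarrow> (\<forall>m<n. \<exists>y. 0 < y \<and> computes f (m # xs) y) \<Longrightarrow>
     computes (RMu f) xs n"

definition computable_machine :: "(bool list \<Rightarrow> bool list option) \<Rightarrow> bool" where
  "computable_machine M \<longleftrightarrow>
     (\<exists>f. \<forall>p y. computes f [code p] y \<longleftrightarrow> (\<exists>x. M p = Some x \<and> y = code x))"

definition uniformly_re :: "(nat \<Rightarrow> bool list set) \<Rightarrow> bool" where
  "uniformly_re W \<longleftrightarrow>
     (\<exists>f. \<forall>n s. s \<in> W n \<longleftrightarrow> (\<exists>y. computes f [n, code s] y))"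

section \<open>Prefix complexity\<close>

definition prefix_machine :: "(bool list \<Rightarrow> bool list option) \<Rightarrow> bool" where
  "prefix_machine M \<longleftrightarrow> computable_machine M \<and>
     (\<forall>p\<in>dom M. \<forall>q\<in>dom M. prefix p q \<longrightarrow> p = q)"

definition optimal_prefix_machine :: "(bool list \<Rightarrow> bool list option) \<Rightarrow> bool" where
  "optimal_prefix_machine U \<longleftrightarrow> prefix_machine U \<and>
     (\<forall>M. prefix_machine M \<longrightarrow>
        (\<exists>d. \<forall>p x. M p = Some x \<longrightarrow> (\<exists>q. U q = Some x \<and> length q \<le> length p + d)))"

definition prefix_complexity :: "(bool list \<Rightarrow> bool list option) \<Rightarrow> bool list \<Rightarrow> nat" where
  "prefix_complexity U x = (LEAST l. \<exists>p. U p = Some x \<and> length p = l)"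

subsection \<open>Representation in Peano arithmetic\<close>

text \<open>
  \<open>\<Psi>(p, x)\<close> is a \<open>\<Sigma>\<^sub>1\<close> definition of the graph of \<open>U\<close> (input in variable 0, output in variable 1),
  and PA proves that what it defines is a function with prefix-free domain.
\<close>

definition represents_prefix_machine :: "fm \<Rightarrow> (bool list \<Rightarrow> bool list option) \<Rightarrow> bool" where
  "represents_prefix_machine \<Psi> U \<longleftrightarrow>
     sigma1 \<Psi> \<and> fv \<Psi> \<subseteq> {0, 1} \<and>
     (\<forall>p x e. U p = Some x \<longleftrightarrow> sat (case_nat (code p) (case_nat (code x) e)) \<Psi>) \<and>
     PA \<turnstile> All (All (All
       (Imp (inst2 \<Psi> (Var 2) (Var 1)) (Imp (inst2 \<Psi> (Var 2) (Var 0)) (Eq (Var 1) (Var 0)))))) \<and>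
     PA \<turnstile> All (All (All (All
       (Imp (inst2 \<Psi> (Var 3) (Var 1)) (Imp (inst2 \<Psi> (Var 2) (Var 0))
         (Imp (prefix_fm (Var 3) (Var 2)) (Eq (Var 3) (Var 2))))))))"

text \<open>\<open>K(x) \<ge> n - c\<close>: every program \<open>p\<close> for \<open>x\<close> satisfies \<open>n \<le> |p| + c\<close>.\<close>

definition K_ge_fm :: "fm \<Rightarrow> tm \<Rightarrow> tm \<Rightarrow> tm \<Rightarrow> fm" where
  "K_ge_fm \<Psi> x n c =
     All (All (Imp (inst2 \<Psi> (Var 1) (lift (lift x)))
       (Imp (len_fm (Var 1) (Var 0))
         (le_fm (lift (lift n)) (Add (Var 0) (lift (lift c)))))))"

definition seq_prefix :: "(nat \<Rightarrow> bool) \<Rightarrow> nat \<Rightarrow> bool list" where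
  "seq_prefix X n = map X [0..<n]"

definition MLR :: "fm \<Rightarrow> nat \<Rightarrow> (nat \<Rightarrow> bool) \<Rightarrow> fm set" where
  "MLR \<Psi> c X =
     PA \<union> {K_ge_fm \<Psi> (numeral_tm (code (seq_prefix X n))) (numeral_tm n) (numeral_tm c) | n. True}"

section \<open>Martin-Loef randomness\<close>

definition coin_measure :: "(nat \<Rightarrow> bool) measure" where
  "coin_measure = PiM UNIV (\<lambda>_. measure_pmf (bernoulli_pmf (1 / 2)))"

definition cylinder :: "bool list \<Rightarrow> (nat \<Rightarrow> bool) set" where
  "cylinder s = {Y. seq_prefix Y (length s) = s}"

definition martin_loef_test :: "(nat \<Rightarrow> bool list set) \<Rightarrow> bool" where
  "martin_loef_test W \<longleftrightarrow> uniformly_re W \<and>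
     (\<forall>n. emeasure coin_measure (\<Union>s\<in>W n. cylinder s) \<le> ennreal ((1 / 2) ^ n))"

definition martin_loef_random :: "(nat \<Rightarrow> bool) \<Rightarrow> bool" where
  "martin_loef_random X \<longleftrightarrow> (\<forall>W. martin_loef_test W \<longrightarrow> X \<notin> (\<Inter>n. \<Union>s\<in>W n. cylinder s))"

section \<open>Adequacy of the definitions\<close>

text \<open>
  Not needed to state the theorem: the calculus is sound, the axioms of PA are true, and the
  arithmetical formulas above have their intended meaning in the standard model.
\<close>

lemma eval_subst_tm: "eval_tm e (subst_tm \<sigma> t) = eval_tm (\<lambda>i. eval_tm e (\<sigma> i)) t"
  by (induction t) auto

lemma eval_lift [simp]: "eval_tm (case_nat n e) (lift t) = eval_tm e t"
  by (simp add: lift_def eval_subst_tm)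

lemma sat_subst_fm: "sat e (subst_fm \<sigma> A) \<longleftrightarrow> sat (\<lambda>i. eval_tm e (\<sigma> i)) A"
proof (induction A arbitrary: e \<sigma>)
  case (All A)
  have "(\<lambda>i. eval_tm (case_nat n e) (up \<sigma> i)) = case_nat n (\<lambda>i. eval_tm e (\<sigma> i))" for n
    by (auto simp: up_def fun_eq_iff split: nat.split)
  with All show ?case by simp
qed (auto simp: eval_subst_tm)

lemma sat_inst: "sat e (inst A t) \<longleftrightarrow> sat (case_nat (eval_tm e t) e) A"
proof -
  have "(\<lambda>i. eval_tm e (case_nat t Var i)) = case_nat (eval_tm e t) e"
    by (auto simp: fun_eq_iff split: nat.split)
  thus ?thesis by (simp add: inst_def sat_subst_fm)
qed

lemma sat_inst2: "sat e (inst2 A s t) \<longleftrightarrow> sat (case_nat (eval_tm e s) (case_nat (eval_tm e t) e)) A"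
proof -
  have "(\<lambda>i. eval_tm e (case_nat s (case_nat t Var) i)) = case_nat (eval_tm e s) (case_nat (eval_tm e t) e)"
    by (auto simp: fun_eq_iff split: nat.split)
  thus ?thesis by (simp add: inst2_def sat_subst_fm)
qed

lemma eval_numeral [simp]: "eval_tm e (numeral_tm n) = n"
  by (induction n) auto

lemma proves_sound: "T \<turnstile> A \<Longrightarrow> (\<And>B e. B \<in> T \<Longrightarrow> sat e B) \<Longrightarrow> sat e A"
proof (induction arbitrary: e rule: proves.induct)
  case (Vac A)
  then show ?case by (simp add: lift_fm_def sat_subst_fm)
qed (auto simp: sat_inst)

lemma sat_PA: "B \<in> PA \<Longrightarrow> sat e B"
proof -
  have ind: "sat e (induction_ax A)" for A
  proof -
    have eq: "(\<lambda>i. eval_tm (case_nat n e) (case_nat (Succ (Var 0)) (\<lambda>i. Var (Suc i)) i)) = case_nat (Suc n) e" for n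
      by (auto simp: fun_eq_iff split: nat.split)
    show ?thesis
      apply (simp add: induction_ax_def sat_inst sat_subst_fm eq)
      apply (intro impI allI)
      subgoal for n by (induction n) auto
      done
  qed
  assume "B \<in> PA" thus ?thesis using ind unfolding PA_def by (auto)
qed

lemma sat_le [simp]: "sat e (le_fm s t) \<longleftrightarrow> eval_tm e s \<le> eval_tm e t"
  by (simp add: le_fm_def le_iff_add) metis

lemma sat_lt [simp]: "sat e (lt_fm s t) \<longleftrightarrow> eval_tm e s < eval_tm e t"
  by (auto simp: lt_fm_def)

definition bt :: "nat \<Rightarrow> nat \<Rightarrow> nat \<Rightarrow> nat" where
  "bt a b i = a mod (Suc (Suc i * b))"

lemma sat_beta [simp]: "sat e (beta_fm a b i y) \<longleftrightarrow> bt (eval_tm e a) (eval_tm e b) (eval_tm e i) = eval_tm e y"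
proof -
  have *: "(y < d \<and> (\<exists>q. a = q * d + y)) \<longleftrightarrow> a mod d = y" if "0 < d" for y a d :: nat
  proof
    assume "y < d \<and> (\<exists>q. a = q * d + y)"
    then obtain q where "y < d" "a = q * d + y" by blast
    thus "a mod d = y" by simp
  next
    assume "a mod d = y"
    thus "y < d \<and> (\<exists>q. a = q * d + y)"
      using that mod_less_divisor[of d a] div_mult_mod_eq[of a d] by metis
  qed
  have "sat e (beta_fm a b i y) \<longleftrightarrow>
      eval_tm e y < Suc (Suc (eval_tm e i) * eval_tm e b) \<and>
      (\<exists>q. eval_tm e a = q * Suc (Suc (eval_tm e i) * eval_tm e b) + eval_tm e y)"
    unfolding beta_fm_def by (simp del: mult_Suc mult_Suc_right)
  also have "\<dots> \<longleftrightarrow> eval_tm e a mod Suc (Suc (eval_tm e i) * eval_tm e b) = eval_tm e y"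
    by (rule *) simp
  finally show ?thesis unfolding bt_def .
qed

lemma beta_ex: "\<exists>a b. \<forall>i\<le>m::nat. bt a b i = f i"
proof -
  define N where "N = Suc m + (\<Sum>i\<le>m. f i)"
  define b where "b = (fact N :: nat)"
  have cop: "coprime (Suc (Suc i * b)) (Suc (Suc j * b))" if ij: "i < j" "j \<le> m" for i j
  proof (rule ccontr)
    assume "\<not> ?thesis"
    hence "gcd (Suc (Suc i * b)) (Suc (Suc j * b)) \<noteq> 1" by (simp only: coprime_iff_gcd_eq_1 not_False_eq_True)
    from prime_factor_nat[OF this] obtain p where
      p: "prime p" "p dvd gcd (Suc (Suc i * b)) (Suc (Suc j * b))" by blast
    hence p: "prime p" "p dvd Suc (Suc i * b)" "p dvd Suc (Suc j * b)"
      by (simp_all only: gcd_greatest_iff)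
    have "p dvd Suc (Suc j * b) - Suc (Suc i * b)" using p(2,3) dvd_diff_nat by blast
    also have "Suc (Suc j * b) - Suc (Suc i * b) = (j - i) * b"
      by (simp add: diff_mult_distrib)
    finally have "p dvd (j - i) \<or> p dvd b" using p(1) prime_dvd_mult_iff by blast
    moreover have "(j - i) dvd b" unfolding b_def by (rule dvd_fact) (use ij in \<open>auto simp: N_def\<close>)
    ultimately have "p dvd b" using dvd_trans by blast
    hence "p dvd Suc i * b" by simp
    from dvd_add_right_iff[OF this, of 1] p(2) have "p dvd 1" by (simp only: Suc_eq_plus1)
    with p(1) show False by auto
  qed
  have cop': "\<forall>i\<in>{..m}. \<forall>j\<in>{..m}. i \<noteq> j \<longrightarrow> coprime (Suc (Suc i * b)) (Suc (Suc j * b))"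
    using cop by (metis atMost_iff coprime_commute linorder_neqE_nat)
  obtain a where a: "\<forall>i\<in>{..m}. [a = f i] (mod Suc (Suc i * b))"
    using chinese_remainder_nat[OF finite_atMost cop'] by blast
  have "bt a b i = f i" if "i \<le> m" for i
  proof -
    have "f i \<le> (\<Sum>i\<le>m. f i)" using that by (intro member_le_sum) auto
    also have "\<dots> \<le> N" by (simp add: N_def)
    also have "N \<le> b" unfolding b_def by (rule fact_ge_self)
    also have "b < Suc (Suc i * b)" by simp
    finally have "f i < Suc (Suc i * b)" .
    thus ?thesis using a that by (simp add: bt_def cong_def)
  qed
  thus ?thesis by blast
qed

lemma sat_pow2 [simp]: "sat e (pow2_fm m y) \<longleftrightarrow> eval_tm e y = 2 ^ eval_tm e m"
proof -
  have "(\<exists>a b. bt a b 0 = Suc 0 \<and> (\<forall>n<M. bt a b (Suc n) = bt a b n + bt a b n) \<and> bt a b M = Y) \<longleftrightarrow> Y = 2 ^ M" for M Y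
  proof
    assume "\<exists>a b. bt a b 0 = Suc 0 \<and> (\<forall>n<M. bt a b (Suc n) = bt a b n + bt a b n) \<and> bt a b M = Y"
    then obtain a b where h: "bt a b 0 = Suc 0" "\<forall>n<M. bt a b (Suc n) = bt a b n + bt a b n" "bt a b M = Y" by blast
    have "k \<le> M \<Longrightarrow> bt a b k = 2 ^ k" for k
      by (induction k) (use h(1,2) in auto)
    thus "Y = 2 ^ M" using h by auto
  next
    assume "Y = 2 ^ M"
    moreover obtain a b where "\<forall>i\<le>M. bt a b i = 2 ^ i" using beta_ex by blast
    ultimately show "\<exists>a b. bt a b 0 = Suc 0 \<and> (\<forall>n<M. bt a b (Suc n) = bt a b n + bt a b n) \<and> bt a b M = Y"
      by (intro exI[of _ a] exI[of _ b]) auto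
  qed
  moreover have "sat e (pow2_fm m y) \<longleftrightarrow> (\<exists>a b. bt a b 0 = Suc 0 \<and>
      (\<forall>n<eval_tm e m. bt a b (Suc n) = bt a b n + bt a b n) \<and> bt a b (eval_tm e m) = eval_tm e y)"
    by (simp add: pow2_fm_def numeral_2_eq_2 numeral_3_eq_3)
  ultimately show ?thesis by simp
qed

lemma code_snoc: "code (s @ [b]) = 2 * code s + 1 + of_bool b" by (simp add: code_def)
lemma code_Nil: "code [] = 0" by (simp add: code_def)

lemma bij_code: "bij code"
proof -
  have inj: "code s = code t \<Longrightarrow> s = t" for s t
  proof (induction s arbitrary: t rule: rev_induct)
    case Nil thus ?case by (cases t rule: rev_cases) (auto simp: code_snoc code_Nil)
  next
    case (snoc b s)
    then obtain t' b' where "t = t' @ [b']" by (cases t rule: rev_cases) (auto simp: code_snoc code_Nil)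
    moreover from this snoc.prems have "b = b' \<and> code s = code t'"
      by (cases b; cases b'; simp add: code_snoc; presburger)
    ultimately show ?case using snoc.IH by auto
  qed
  have surj: "\<exists>s. n = code s" for n
  proof (induction n rule: less_induct)
    case (less n)
    show ?case
    proof (cases n)
      case 0 thus ?thesis using code_Nil by metis
    next
      case (Suc k)
      then obtain s where "k div 2 = code s" using less.IH[of "k div 2"] by (metis div_le_dividend le_imp_less_Suc)
      hence c: "code s = k div 2" by simp
      have "code (s @ [odd k]) = n" unfolding code_snoc c using Suc by (cases "odd k") auto
      thus ?thesis by metis
    qed
  qed
  show ?thesis using inj surj by (metis bijI injI surj_def)
qed

lemma code_append: "Suc (code (s @ t)) = Suc (code s) * 2 ^ length t + (Suc (code t) - 2 ^ length t) \<and> 2 ^ length t \<le> Suc (code t) \<and> Suc (code t) < 2 * 2 ^ length t"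
proof (induction t rule: rev_induct)
  case Nil thus ?case by (simp add: code_Nil)
next
  case (snoc b t)
  obtain r where r: "Suc (code t) = 2 ^ length t + r" using snoc by (metis le_iff_add)
  have 1: "code (s @ t @ [b]) = 2 * code (s @ t) + 1 + of_bool b" using code_snoc[of "s @ t"] by simp
  show ?case using snoc r unfolding 1 code_snoc by (cases b; simp add: algebra_simps)
qed

lemma sat_len: "sat e (len_fm p l) \<longleftrightarrow> eval_tm e l = length (inv code (eval_tm e p))"
proof -
  obtain s where s: "eval_tm e p = code s" using bij_code by (metis bij_pointE)
  have b: "2 ^ length s \<le> Suc (code s)" "Suc (code s) < 2 * 2 ^ length s" using code_append[of "[]" s] by auto
  have *: "(2 ^ l \<le> Suc (code s) \<and> Suc (code s) < 2 ^ l + 2 ^ l) \<longleftrightarrow> l = length s" for l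
  proof
    assume l: "2 ^ l \<le> Suc (code s) \<and> Suc (code s) < 2 ^ l + 2 ^ l"
    hence "(2::nat) ^ l < 2 ^ Suc (length s)" "(2::nat) ^ length s < 2 ^ Suc l" using b by auto
    hence "l < Suc (length s)" "length s < Suc l" by (metis power_less_imp_less_exp one_less_numeral_iff semiring_norm(76))+
    thus "l = length s" by simp
  qed (use b in auto)
  show ?thesis using * s bij_code by (simp add: len_fm_def bij_is_inj)
qed

lemma sat_prefix: "sat e (prefix_fm p q) \<longleftrightarrow> prefix (inv code (eval_tm e p)) (inv code (eval_tm e q))"
proof -
  obtain s t where s: "eval_tm e p = code s" "eval_tm e q = code t" using bij_code by (metis bij_pointE)
  have "(\<exists>m r. r < 2 ^ m \<and> Suc (code t) = Suc (code s) * 2 ^ m + r) \<longleftrightarrow> prefix s t"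
  proof
    assume "prefix s t"
    then obtain u where "t = s @ u" by (auto simp: prefix_def)
    with code_append[of s u] show "\<exists>m r. r < 2 ^ m \<and> Suc (code t) = Suc (code s) * 2 ^ m + r"
      by (intro exI[of _ "length u"] exI[of _ "Suc (code u) - 2 ^ length u"]) auto
  next
    assume "\<exists>m r. r < 2 ^ m \<and> Suc (code t) = Suc (code s) * 2 ^ m + r"
    then obtain m r where r: "r < 2 ^ m" "Suc (code t) = Suc (code s) * 2 ^ m + r" by blast
    have "\<exists>u. code (s @ u) = code t" using r
    proof (induction m arbitrary: r t)
      case 0 thus ?case by (intro exI[of _ "[]"]) simp
    next
      case (Suc m)
      obtain t' where t': "code t' = Suc (code s) * 2 ^ m + r div 2 - 1" using bij_code by (metis bij_pointE)
      have pos: "Suc (code s) * 2 ^ m > 0" by simp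
      have "Suc (code t') = Suc (code s) * 2 ^ m + r div 2" using t' pos by linarith
      moreover have "r div 2 < 2 ^ m" using Suc.prems by auto
      ultimately obtain u where u: "code (s @ u) = code t'" using Suc.IH by blast
      have "code (s @ u @ [odd r]) = 2 * code t' + 1 + of_bool (odd r)" using code_snoc[of "s @ u"] u by simp
      also have "\<dots> = 2 * Suc (code t') + r mod 2 - 1" by (auto simp: mod_2_eq_odd)
      also have "\<dots> = code t" using Suc.prems \<open>Suc (code t') = _\<close> by (simp add: algebra_simps)
      finally show ?case by blast
    qed
    then obtain u where "s @ u = t" using bij_code by (metis bij_is_inj injD)
    thus "prefix s t" by (auto simp: prefix_def)
  qed
  moreover have "sat e (prefix_fm p q) \<longleftrightarrow>
      (\<exists>m r. r < 2 ^ m \<and> Suc (code t) = Suc (code s) * 2 ^ m + r)"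
    by (simp add: prefix_fm_def s numeral_2_eq_2 del: power_Suc mult_Suc)
  moreover have "inv code (eval_tm e p) = s" "inv code (eval_tm e q) = t"
    using s bij_code by (simp_all add: bij_is_inj)
  ultimately show ?thesis by (simp only:)
qed

lemma sat_K_ge:
  assumes r: "represents_prefix_machine \<Psi> U" and x: "x \<in> ran U"
  shows "sat e (K_ge_fm \<Psi> (numeral_tm (code x)) (numeral_tm n) (numeral_tm c))
     \<longleftrightarrow> int (prefix_complexity U x) \<ge> int n - int c"
proof -
  have U: "sat (case_nat (code p) (case_nat (code x) e)) \<Psi> \<longleftrightarrow> U p = Some x" for p x e
    using r by (simp add: represents_prefix_machine_def)
  have inv: "inv code (code p) = p" for p using bij_code by (simp add: bij_is_inj)
  have "code (inv code p) = p" for p using bij_code by (simp add: bij_is_surj surj_f_inv_f)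
  with U have U': "sat (case_nat p (case_nat (code x) e)) \<Psi> \<longleftrightarrow> U (inv code p) = Some x" for p x e
    by metis
  have "sat e (K_ge_fm \<Psi> (numeral_tm (code x)) (numeral_tm n) (numeral_tm c))
     \<longleftrightarrow> (\<forall>p. U (inv code p) = Some x \<longrightarrow> n \<le> length (inv code p) + c)"
    by (simp add: K_ge_fm_def sat_inst2 sat_len U')
  also have "\<dots> \<longleftrightarrow> (\<forall>p. U p = Some x \<longrightarrow> n \<le> length p + c)"
    using inv by metis
  also have "\<dots> \<longleftrightarrow> n \<le> prefix_complexity U x + c"
  proof -
    obtain p0 where p0: "U p0 = Some x" using x by (auto simp: ran_def)
    have "\<exists>p. U p = Some x \<and> length p = prefix_complexity U x"
      unfolding prefix_complexity_def by (rule LeastI[of _ "length p0"]) (use p0 in auto)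
    moreover have "prefix_complexity U x \<le> length p" if "U p = Some x" for p
      unfolding prefix_complexity_def by (rule Least_le) (use that in auto)
    ultimately show ?thesis by (metis add_le_mono1 order_trans)
  qed
  finally show ?thesis by linarith
qed

end

theory Submission
  imports Defs
begin

text \<open>
  Let \<open>W\<^sub>c\<close> be the set of strings \<open>s\<close> such that PA with the axioms \<open>K(t) \<ge> |t| - c\<close> for the prefixes
  \<open>t\<close> of \<open>s\<close> proves \<open>\<phi>\<close>. The \<open>W\<^sub>c\<close> are uniformly recursively enumerable, and by compactness of
  proofs every \<open>W\<^sub>c\<close> contains a prefix of \<open>X\<close>. If PA does not prove \<open>\<phi>\<close>, take a model of PA in which
  \<open>\<phi>\<close> fails. For \<open>s\<close> in \<open>W\<^sub>c\<close> some axiom fails in the model, so in the model some prefix \<open>t\<close> of \<open>s\<close>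
  has a program of length less than \<open>|t| - c\<close>. This length is standard, hence so is the program. Since
  PA proves that the machine is a prefix-free function, the standard programs of the model satisfy the
  Kraft inequality, and \<open>W\<^sub>c\<close> covers a set of measure at most \<open>2\<^sup>-\<^sup>c\<close>. So the \<open>W\<^sub>c\<close> form a
  Martin-Loef test that captures \<open>X\<close>.
\<close>

section \<open>Total recursive functions\<close>

text \<open>The axioms about a random \<open>X\<close> come with no effective enumeration, so the
  test has to be enumerated from finite strings. The model enters only into the measure bound: the
  sets are enumerated from syntax alone, hence the test is effective although nothing is known about
  the complexity of the model, and one model bounds all \<open>W\<^sub>c\<close> at once. The bound
  cannot be taken from the actual machine, because a nonstandard model may contain halting programs
  that never halt in reality. What survives in the model is only what PA proves about
  \<open>\<Psi>\<close>. These laws speak about real strings as soon as the program is a numeral,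
  and it is one because the numerals form an initial segment of every model of PA. The longest part
  is effectivity, since \<open>uniformly_re\<close> asks for an index in \<open>recf\<close>. No
  program for provability is written down. A total function is recursive once its graph is r.e., and
  both graphs of syntactic operations and provability are inductively defined. Derivations are
  sequences, which Goedel's beta function codes by two numbers, so that membership becomes an
  existential statement with bounded universal quantifiers.\<close>

text \<open>Indices in \<open>recf\<close> carry no arity, so only lists of length \<open>k\<close>
  are constrained. Argument lists occur just in this bottom layer; later functions are unary on
  coded types.\<close>

definition total_recursive :: "nat \<Rightarrow> (nat list \<Rightarrow> nat) \<Rightarrow> bool" where
  "total_recursive k f \<longleftrightarrow> (\<exists>r. \<forall>xs. length xs = k \<longrightarrow> (\<forall>y. computes r xs y \<longleftrightarrow> y = f xs))"

lemma total_recursive_cong: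
  "total_recursive k f \<Longrightarrow> (\<And>xs. length xs = k \<Longrightarrow> f xs = g xs) \<Longrightarrow> total_recursive k g"
  unfolding total_recursive_def by metis

lemma total_recursive_zero: "total_recursive k (\<lambda>xs. 0)"
  unfolding total_recursive_def by (rule exI[of _ RZero]) (subst computes.simps, simp)

lemma total_recursive_Suc: "total_recursive 1 (\<lambda>xs. Suc (hd xs))"
  unfolding total_recursive_def
  by (rule exI[of _ RSucc], subst computes.simps) (auto simp: length_Suc_conv)

lemma total_recursive_nth: "i < k \<Longrightarrow> total_recursive k (\<lambda>xs. xs ! i)"
  unfolding total_recursive_def by (rule exI[of _ "RProj i"]) (subst computes.simps, simp)

lemma total_recursive_comp:
  assumes f: "total_recursive (length gs) f" and gs: "\<And>g. g \<in> set gs \<Longrightarrow> total_recursive k g"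
  shows "total_recursive k (\<lambda>xs. f (map (\<lambda>g. g xs) gs))"
proof -
  have "\<exists>rs. list_all2 (\<lambda>r g. \<forall>xs. length xs = k \<longrightarrow> (\<forall>y. computes r xs y \<longleftrightarrow> y = g xs)) rs gs"
    using gs
  proof (induction gs)
    case (Cons g gs)
    then obtain rs where "list_all2 (\<lambda>r g. \<forall>xs. length xs = k \<longrightarrow> (\<forall>y. computes r xs y \<longleftrightarrow> y = g xs)) rs gs"
      by auto
    moreover obtain r where "\<forall>xs. length xs = k \<longrightarrow> (\<forall>y. computes r xs y \<longleftrightarrow> y = g xs)"
      using Cons.prems[of g] by (auto simp: total_recursive_def)
    ultimately show ?case by (intro exI[of _ "r # rs"]) simp
  qed simp
  then obtain rs where
    rs: "list_all2 (\<lambda>r g. \<forall>xs. length xs = k \<longrightarrow> (\<forall>y. computes r xs y \<longleftrightarrow> y = g xs)) rs gs" ..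
  \<comment> \<open>Each index has exactly one value at \<open>xs\<close>, so the intermediate list
    in the rule for \<open>RComp\<close> is forced.\<close>
  have *: "list_all2 (\<lambda>r y. computes r xs y) rs ys \<longleftrightarrow> ys = map (\<lambda>g. g xs) gs"
    if "length xs = k" for xs ys
    using rs that
  proof (induction rs gs arbitrary: ys rule: list_all2_induct)
    case (Cons r rs g gs)
    then show ?case by (cases ys) auto
  qed simp
  obtain r where r: "\<forall>xs. length xs = length gs \<longrightarrow> (\<forall>y. computes r xs y \<longleftrightarrow> y = f xs)"
    using f by (auto simp: total_recursive_def)
  show ?thesis unfolding total_recursive_def
    by (rule exI[of _ "RComp r rs"], subst computes.simps) (use r in \<open>simp add: *\<close>)
qed

lemma total_recursive_comp1:
  "total_recursive 1 f \<Longrightarrow> total_recursive k g \<Longrightarrow> total_recursive k (\<lambda>xs. f [g xs])"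
  using total_recursive_comp[of "[g]" f k] by simp

lemma total_recursive_comp2:
  "total_recursive 2 f \<Longrightarrow> total_recursive k g \<Longrightarrow> total_recursive k h \<Longrightarrow>
    total_recursive k (\<lambda>xs. f [g xs, h xs])"
  using total_recursive_comp[of "[g, h]" f k] by (auto simp: numeral_2_eq_2)

lemma total_recursive_prim:
  assumes f: "total_recursive k f" and g: "total_recursive (Suc (Suc k)) g"
  shows "total_recursive (Suc k) (\<lambda>xs. rec_nat (f (tl xs)) (\<lambda>n y. g (n # y # tl xs)) (hd xs))"
proof -
  obtain r where r: "\<forall>xs. length xs = k \<longrightarrow> (\<forall>y. computes r xs y \<longleftrightarrow> y = f xs)"
    using f by (auto simp: total_recursive_def)
  obtain s where s: "\<forall>xs. length xs = Suc (Suc k) \<longrightarrow> (\<forall>y. computes s xs y \<longleftrightarrow> y = g xs)"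
    using g by (auto simp: total_recursive_def)
  have "computes (RPrim r s) (n # xs) y \<longleftrightarrow> y = rec_nat (f xs) (\<lambda>n y. g (n # y # xs)) n"
    if "length xs = k" for n xs y
  proof (induction n arbitrary: y)
    case 0
    show ?case using r that by (subst computes.simps) simp
  next
    case (Suc n)
    show ?case using s that by (subst computes.simps) (simp add: Suc)
  qed
  thus ?thesis unfolding total_recursive_def
    by (intro exI[of _ "RPrim r s"]) (auto simp: length_Suc_conv)
qed

lemma computes_RMu:
  assumes "\<And>n y. computes r (n # xs) y \<longleftrightarrow> y = q (n # xs)"
  shows "computes (RMu r) xs y \<longleftrightarrow> q (y # xs) = 0 \<and> (\<forall>m<y. q (m # xs) \<noteq> 0)"
  by (subst computes.simps) (auto simp: assms neq0_conv[symmetric] simp del: neq0_conv)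

lemma total_recursive_Least:
  assumes q: "total_recursive (Suc k) q"
    and ex: "\<And>xs. length xs = k \<Longrightarrow> \<exists>n. q (n # xs) = 0"
  shows "total_recursive k (\<lambda>xs. LEAST n. q (n # xs) = 0)"
proof -
  obtain r where r: "\<forall>xs. length xs = Suc k \<longrightarrow> (\<forall>y. computes r xs y \<longleftrightarrow> y = q xs)"
    using q by (auto simp: total_recursive_def)
  have "computes (RMu r) xs y \<longleftrightarrow> y = (LEAST n. q (n # xs) = 0)" if "length xs = k" for xs y
  proof -
    have "computes (RMu r) xs y \<longleftrightarrow> q (y # xs) = 0 \<and> (\<forall>m<y. q (m # xs) \<noteq> 0)"
      by (rule computes_RMu) (use r that in simp)
    also have "\<dots> \<longleftrightarrow> y = (LEAST n. q (n # xs) = 0)"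
    proof
      assume "q (y # xs) = 0 \<and> (\<forall>m<y. q (m # xs) \<noteq> 0)"
      thus "y = (LEAST n. q (n # xs) = 0)" by (intro Least_equality[symmetric]) (auto simp: not_less[symmetric])
    next
      assume y: "y = (LEAST n. q (n # xs) = 0)"
      from ex[OF that] obtain n where "q (n # xs) = 0" ..
      from LeastI[of "\<lambda>n. q (n # xs) = 0", OF this] y show "q (y # xs) = 0 \<and> (\<forall>m<y. q (m # xs) \<noteq> 0)"
        using not_less_Least by auto
    qed
    finally show ?thesis .
  qed
  thus ?thesis by (auto simp: total_recursive_def)
qed

section \<open>Arithmetic functions and bounded quantifiers\<close>

lemma total_recursive_const: "total_recursive k (\<lambda>xs. c)"
proof (induction c)
  case (Suc c)
  from total_recursive_comp1[OF total_recursive_Suc Suc] show ?case by simp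
qed (rule total_recursive_zero)

lemma total_recursive_add2: "total_recursive 2 (\<lambda>xs. xs ! 0 + xs ! 1)"
proof -
  have "total_recursive 3 (\<lambda>xs. xs ! 1)" by (rule total_recursive_nth) simp
  from total_recursive_comp1[OF total_recursive_Suc this]
  have "total_recursive (Suc (Suc 1)) (\<lambda>xs. Suc (xs ! 1))" by (simp add: numeral_3_eq_3)
  moreover have "total_recursive 1 (\<lambda>xs. xs ! 0)" by (rule total_recursive_nth) simp
  ultimately have "total_recursive (Suc 1) (\<lambda>xs. rec_nat (tl xs ! 0) (\<lambda>n y. Suc ((n # y # tl xs) ! 1)) (hd xs))"
    by (rule total_recursive_prim[rotated])
  moreover have "rec_nat b (\<lambda>n y. Suc y) a = a + b" for a b :: nat by (induction a) auto
  ultimately show ?thesis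
    unfolding numeral_2_eq_2 One_nat_def
    by (elim total_recursive_cong) (auto simp: length_Suc_conv)
qed

lemma total_recursive_add:
  "total_recursive k f \<Longrightarrow> total_recursive k g \<Longrightarrow> total_recursive k (\<lambda>xs. f xs + g xs)"
  using total_recursive_comp2[OF total_recursive_add2, of k f g] by simp

lemma total_recursive_mult2: "total_recursive 2 (\<lambda>xs. xs ! 0 * xs ! 1)"
proof -
  have "total_recursive (Suc (Suc 1)) (\<lambda>xs. xs ! 1 + xs ! 2)"
    by (intro total_recursive_add total_recursive_nth) simp_all
  from total_recursive_prim[OF total_recursive_zero this]
  have "total_recursive (Suc 1) (\<lambda>xs. rec_nat 0 (\<lambda>n y. y + tl xs ! 0) (hd xs))" by simp
  moreover have "rec_nat 0 (\<lambda>n y. y + b) a = a * b" for a b :: nat by (induction a) auto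
  ultimately show ?thesis
    unfolding numeral_2_eq_2 One_nat_def
    by (elim total_recursive_cong) (auto simp: length_Suc_conv)
qed

lemma total_recursive_mult:
  "total_recursive k f \<Longrightarrow> total_recursive k g \<Longrightarrow> total_recursive k (\<lambda>xs. f xs * g xs)"
  using total_recursive_comp2[OF total_recursive_mult2, of k f g] by simp

lemma total_recursive_pred: "total_recursive 1 (\<lambda>xs. hd xs - 1)"
proof -
  have "total_recursive (Suc (Suc 0)) (\<lambda>xs. xs ! 0)" by (rule total_recursive_nth) simp
  from total_recursive_prim[OF total_recursive_zero this]
  have "total_recursive (Suc 0) (\<lambda>xs. rec_nat 0 (\<lambda>n y. n) (hd xs))" by simp
  moreover have "rec_nat 0 (\<lambda>n y. n) a = a - 1" for a :: nat by (cases a) auto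
  ultimately show ?thesis by (simp only: One_nat_def)
qed

lemma total_recursive_diff:
  assumes "total_recursive k f" "total_recursive k g"
  shows "total_recursive k (\<lambda>xs. f xs - g xs)"
proof -
  have "total_recursive (Suc (Suc 1)) (\<lambda>xs. xs ! 1)" by (rule total_recursive_nth) simp
  from total_recursive_comp1[OF total_recursive_pred this]
  have "total_recursive (Suc (Suc 1)) (\<lambda>xs. xs ! 1 - 1)" by simp
  moreover have "total_recursive 1 (\<lambda>xs. xs ! 0)" by (rule total_recursive_nth) simp
  ultimately have "total_recursive (Suc 1) (\<lambda>xs. rec_nat (tl xs ! 0) (\<lambda>n y. (n # y # tl xs) ! 1 - 1) (hd xs))"
    by (rule total_recursive_prim[rotated])
  moreover have "rec_nat b (\<lambda>n y. y - Suc 0) a = b - a" for a b :: nat by (induction a) auto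
  ultimately have "total_recursive 2 (\<lambda>xs. xs ! 1 - xs ! 0)"
    unfolding numeral_2_eq_2 One_nat_def
    by (elim total_recursive_cong) (auto simp: length_Suc_conv)
  \<comment> \<open>The recursion runs on the subtrahend, which is therefore the first
    argument.\<close>
  from total_recursive_comp2[OF this assms(2,1)] show ?thesis by simp
qed

text \<open>A natural number encodes a truth value, with \<open>0\<close> for truth, so that bounded existential
  quantification becomes a product and bounded universal quantification a sum.\<close>

lemma total_recursive_bounded:
  assumes q: "total_recursive (Suc k) q" and op: "total_recursive 2 (\<lambda>xs. h (xs ! 0) (xs ! 1))"
  shows "total_recursive (Suc k) (\<lambda>xs. rec_nat c (\<lambda>n y. h y (q (n # tl xs))) (hd xs))"
proof -
  \<comment> \<open>In the recursion step the arguments are the counter, the accumulated value and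
    the parameters. This list drops the accumulated value, which \<open>q\<close> does not
    take.\<close>
  let ?gs = "(\<lambda>xs. xs ! 0) # map (\<lambda>i xs. xs ! (i + 2)) [0..<k]"
  have "total_recursive (Suc (Suc k)) (\<lambda>xs. q (map (\<lambda>g. g xs) ?gs))"
    by (rule total_recursive_comp) (use q in \<open>auto intro!: total_recursive_nth\<close>)
  moreover have "map (\<lambda>g. g xs) ?gs = xs ! 0 # tl (tl xs)" if "length xs = Suc (Suc k)" for xs :: "nat list"
    using that by (auto simp: length_Suc_conv intro!: nth_equalityI)
  ultimately have "total_recursive (Suc (Suc k)) (\<lambda>xs. q (xs ! 0 # tl (tl xs)))"
    by (elim total_recursive_cong) (simp only:)
  moreover have "total_recursive (Suc (Suc k)) (\<lambda>xs. xs ! 1)" by (rule total_recursive_nth) simp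
  ultimately have "total_recursive (Suc (Suc k)) (\<lambda>xs. h (xs ! 1) (q (xs ! 0 # tl (tl xs))))"
    using total_recursive_comp2[OF op] by simp
  from total_recursive_prim[OF total_recursive_const this, of c] show ?thesis by simp
qed

lemma total_recursive_bex:
  assumes "total_recursive (Suc k) q"
  shows "\<exists>q'. total_recursive (Suc k) q' \<and> (\<forall>n xs. q' (n # xs) = 0 \<longleftrightarrow> (\<exists>i<n. q (i # xs) = 0))"
proof -
  have "rec_nat 1 (\<lambda>n y. y * q (n # xs)) n = 0 \<longleftrightarrow> (\<exists>i<n. q (i # xs) = 0)" for n xs
    by (induction n) (auto simp: less_Suc_eq)
  with total_recursive_bounded[OF assms total_recursive_mult2, of 1] show ?thesis by (intro exI conjI) auto
qed

lemma total_recursive_ball: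
  assumes "total_recursive (Suc k) q"
  shows "\<exists>q'. total_recursive (Suc k) q' \<and> (\<forall>n xs. q' (n # xs) = 0 \<longleftrightarrow> (\<forall>i<n. q (i # xs) = 0))"
proof -
  have "rec_nat 0 (\<lambda>n y. y + q (n # xs)) n = 0 \<longleftrightarrow> (\<forall>i<n. q (i # xs) = 0)" for n xs
    by (induction n) (auto simp: less_Suc_eq)
  with total_recursive_bounded[OF assms total_recursive_add2, of 0] show ?thesis by (intro exI conjI) auto
qed

section \<open>The Cantor pairing function\<close>

lemma total_recursive_triangle: "total_recursive 1 (\<lambda>xs. triangle (hd xs))"
proof -
  have "total_recursive 2 (\<lambda>xs. xs ! 1 + (xs ! 0 + 1))"
    by (intro total_recursive_add total_recursive_nth total_recursive_const) simp_all
  hence "total_recursive (Suc (Suc 0)) (\<lambda>xs. xs ! 1 + (xs ! 0 + 1))" by (simp add: numeral_2_eq_2)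
  from total_recursive_prim[OF total_recursive_zero this]
  have "total_recursive (Suc 0) (\<lambda>xs. rec_nat 0 (\<lambda>n y. Suc (y + n)) (hd xs))" by simp
  moreover have "rec_nat 0 (\<lambda>n y. Suc (y + n)) a = triangle a" for a by (induction a) auto
  ultimately show ?thesis by simp
qed

text \<open>\<open>prod_encode (m, n)\<close> is \<open>triangle (m + n) + m\<close>.\<close>

lemma total_recursive_prod_encode:
  assumes "total_recursive k f" "total_recursive k g"
  shows "total_recursive k (\<lambda>xs. prod_encode (f xs, g xs))"
  unfolding prod_encode_def
  using total_recursive_add[OF total_recursive_comp1[OF total_recursive_triangle total_recursive_add[OF assms]] assms(1)]
  by simp

lemma prod_decode_le: "fst (prod_decode n) \<le> n" "snd (prod_decode n) \<le> n"
  by (metis le_prod_encode_1 prod.collapse prod_decode_inverse,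
      metis le_prod_encode_2 prod.collapse prod_decode_inverse)

text \<open>Each projection is found by unbounded search, with a bounded search for the other component.\<close>

lemma total_recursive_prod_decode:
  shows "total_recursive 1 (\<lambda>xs. fst (prod_decode (hd xs)))"
    and "total_recursive 1 (\<lambda>xs. snd (prod_decode (hd xs)))"
proof -
  \<comment> \<open>One search serves both projections: \<open>a\<close> is the component sought,
    \<open>i\<close> the other one, and \<open>e\<close> pairs them in the right order.\<close>
  have search: "total_recursive 1 (\<lambda>xs. p (prod_decode (hd xs)))"
    if e: "total_recursive 3 (\<lambda>xs. e (xs ! 0) (xs ! 1))"
      and pe: "\<And>z a. (\<exists>i<Suc z. e i a = z) \<longleftrightarrow> p (prod_decode z) = a" for p e
  proof -
    \<comment> \<open>Truncated subtraction in both directions: the sum vanishes exactly on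
      equality.\<close>
    have "total_recursive (Suc 2) (\<lambda>xs. (e (xs ! 0) (xs ! 1) - xs ! 2) + (xs ! 2 - e (xs ! 0) (xs ! 1)))"
      using e by (intro total_recursive_add total_recursive_diff total_recursive_nth) (simp_all add: numeral_3_eq_3)
    moreover have "(a - b) + (b - a) = 0 \<longleftrightarrow> a = b" for a b :: nat by auto
    ultimately obtain q where q: "total_recursive 3 q"
      "\<forall>n xs. q (n # xs) = 0 \<longleftrightarrow> (\<exists>i<n. e i (xs ! 0) = xs ! 1)"
      using total_recursive_bex[of 2 "\<lambda>xs. (e (xs ! 0) (xs ! 1) - xs ! 2) + (xs ! 2 - e (xs ! 0) (xs ! 1))"]
      by (auto simp only: numeral_2_eq_2 numeral_3_eq_3 nth_Cons_0 nth_Cons_Suc One_nat_def)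
    \<comment> \<open>Applied to \<open>[a, z]\<close> this gives \<open>[Suc z, a, z]\<close>. The
      bound \<open>Suc z\<close> suffices since both components of a pair are at most its
      code.\<close>
    let ?gs = "[\<lambda>xs. xs ! 1 + 1, \<lambda>xs. xs ! 0, \<lambda>xs. xs ! 1] :: (nat list \<Rightarrow> nat) list"
    have "total_recursive 2 (\<lambda>xs. q (map (\<lambda>g. g xs) ?gs))"
    proof (rule total_recursive_comp)
      have "total_recursive 2 (\<lambda>xs. xs ! 1 + 1)" "total_recursive 2 (\<lambda>xs. xs ! 0)"
        "total_recursive 2 (\<lambda>xs. xs ! 1)"
        by (intro total_recursive_add total_recursive_nth total_recursive_const, simp_all)+
      thus "total_recursive 2 g" if "g \<in> set ?gs" for g using that
        by (simp only: list.set insert_iff empty_iff simp_thms) (elim disjE, simp_all only:)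
      show "total_recursive (length ?gs) q" using q(1) by (simp add: numeral_3_eq_3)
    qed
    hence "total_recursive (Suc 1) (\<lambda>xs. q [Suc (xs ! 1), xs ! 0, xs ! 1])" by (simp add: numeral_2_eq_2)
    hence "total_recursive 1 (\<lambda>xs. LEAST n. q [Suc ((n # xs) ! 1), (n # xs) ! 0, (n # xs) ! 1] = 0)"
      by (rule total_recursive_Least) (use q pe in simp)
    moreover have "(LEAST n. q [Suc ((n # xs) ! 1), (n # xs) ! 0, (n # xs) ! 1] = 0) = p (prod_decode (hd xs))"
      if len: "length xs = 1" for xs
    proof -
      obtain z where xs: "xs = [z]" using len by (auto simp: length_Suc_conv)
      have "q [Suc z, n, z] = 0 \<longleftrightarrow> p (prod_decode z) = n" for n using q(2) pe[of z n] by simp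
      thus ?thesis by (simp add: xs Least_equality)
    qed
    ultimately show ?thesis by (rule total_recursive_cong)
  qed
  have "(\<exists>i<Suc z. prod_encode (a, i) = z) \<longleftrightarrow> fst (prod_decode z) = a" for z a
  proof
    assume "fst (prod_decode z) = a"
    thus "\<exists>i<Suc z. prod_encode (a, i) = z"
      using prod_decode_le[of z] by (intro exI[of _ "snd (prod_decode z)"]) (auto simp: less_Suc_eq_le)
  qed auto
  thus "total_recursive 1 (\<lambda>xs. fst (prod_decode (hd xs)))"
    by (intro search[where e = "\<lambda>i a. prod_encode (a, i)"])
       (auto intro!: total_recursive_prod_encode total_recursive_nth)
  have "(\<exists>i<Suc z. prod_encode (i, a) = z) \<longleftrightarrow> snd (prod_decode z) = a" for z a
  proof
    assume "snd (prod_decode z) = a"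
    thus "\<exists>i<Suc z. prod_encode (i, a) = z"
      using prod_decode_le[of z] by (intro exI[of _ "fst (prod_decode z)"]) (auto simp: less_Suc_eq_le)
  qed auto
  thus "total_recursive 1 (\<lambda>xs. snd (prod_decode (hd xs)))"
    by (intro search[where e = "\<lambda>i a. prod_encode (i, a)"])
       (auto intro!: total_recursive_prod_encode total_recursive_nth)
qed

section \<open>Recursively enumerable predicates on coded types\<close>

text \<open>Codes are bijective, not merely injective: every number is a code, \<open>dec\<close> is
  total, and quantifying over the type is quantifying over numbers without a test for
  validity.\<close>

class coded =
  fixes enc :: "'a \<Rightarrow> nat"
  assumes bij_enc: "bij enc"
begin

definition dec :: "nat \<Rightarrow> 'a" where "dec = inv enc"

lemma dec_enc [simp]: "dec (enc x) = x"
  unfolding dec_def using bij_enc by (simp add: bij_is_inj)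

lemma enc_dec [simp]: "enc (dec n) = n"
  unfolding dec_def using bij_enc by (simp add: bij_is_surj surj_f_inv_f)

lemma enc_eq_iff [simp]: "enc x = enc y \<longleftrightarrow> x = y"
  by (metis dec_enc)

end

instantiation nat :: coded
begin
definition enc_nat :: "nat \<Rightarrow> nat" where "enc_nat n = n"
instance by standard (simp add: enc_nat_def[abs_def] flip: id_def)
end

lemma enc_nat [simp]: "enc n = (n :: nat)" "dec n = (n :: nat)"
  using enc_dec[of n, where 'a = nat] by (simp_all add: enc_nat_def)

instantiation prod :: (coded, coded) coded
begin
definition enc_prod :: "'a \<times> 'b \<Rightarrow> nat" where "enc_prod z = prod_encode (map_prod enc enc z)"
instance
proof
  have "bij (map_prod enc enc :: 'a \<times> 'b \<Rightarrow> nat \<times> nat)"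
    using bij_enc[where 'a = 'a] bij_enc[where 'a = 'b]
    by (simp add: bij_def prod.inj_map map_prod_surj)
  thus "bij (enc :: 'a \<times> 'b \<Rightarrow> nat)"
    using bij_comp[OF _ bij_prod_encode, of "map_prod enc enc :: 'a \<times> 'b \<Rightarrow> nat \<times> nat"]
    by (simp add: enc_prod_def[abs_def] comp_def)
qed
end

lemma enc_Pair [simp]: "enc (x, y) = prod_encode (enc x, enc y)"
  by (simp add: enc_prod_def)

lemma dec_prod: "dec n = (dec (fst (prod_decode n)), dec (snd (prod_decode n)))"
proof -
  have "enc (dec (fst (prod_decode n)) :: 'a, dec (snd (prod_decode n)) :: 'b) = n" by simp
  thus ?thesis by (metis dec_enc)
qed

definition recursive :: "('a::coded \<Rightarrow> 'b::coded) \<Rightarrow> bool" where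
  "recursive f \<longleftrightarrow> total_recursive 1 (\<lambda>xs. enc (f (dec (hd xs))))"

lemma recursive_id: "recursive (\<lambda>x. x)"
  unfolding recursive_def
  by (rule total_recursive_cong[OF total_recursive_nth[of 0]]) (auto simp: length_Suc_conv)

lemma recursive_const: "recursive (\<lambda>x. c)"
  unfolding recursive_def by (rule total_recursive_const)

lemma recursive_comp: "recursive f \<Longrightarrow> recursive g \<Longrightarrow> recursive (\<lambda>x. f (g x))"
  unfolding recursive_def by (drule (1) total_recursive_comp1) simp

lemma recursive_Pair: "recursive f \<Longrightarrow> recursive g \<Longrightarrow> recursive (\<lambda>x. (f x, g x))"
  unfolding recursive_def by (drule (1) total_recursive_prod_encode) simp

lemma recursive_fst: "recursive f \<Longrightarrow> recursive (\<lambda>x. fst (f x))"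
  by (erule recursive_comp[rotated])
    (use total_recursive_prod_decode(1) in \<open>simp add: recursive_def dec_prod\<close>)

lemma recursive_snd: "recursive f \<Longrightarrow> recursive (\<lambda>x. snd (f x))"
  by (erule recursive_comp[rotated])
    (use total_recursive_prod_decode(2) in \<open>simp add: recursive_def dec_prod\<close>)

text \<open>Both sides unfold to the same condition, as \<open>enc\<close> is the identity on
  \<open>nat\<close>. Recursiveness of a constructor thus reduces to the arithmetic formula for its
  code.\<close>

lemma recursive_enc_iff: "recursive (\<lambda>x. enc (f x)) \<longleftrightarrow> recursive f"
  by (simp add: recursive_def)

lemma recursive_enc: "recursive f \<Longrightarrow> recursive (\<lambda>x. enc (f x))"
  by (simp add: recursive_enc_iff)

lemma recursive_dec: "recursive f \<Longrightarrow> recursive (\<lambda>x. dec (f x))"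
  by (simp add: recursive_def)

lemma recursive_Suc: "recursive f \<Longrightarrow> recursive (\<lambda>x. Suc (f x))"
  by (erule recursive_comp[rotated]) (use total_recursive_Suc in \<open>simp add: recursive_def\<close>)

lemma recursive_add: "recursive f \<Longrightarrow> recursive g \<Longrightarrow> recursive (\<lambda>x. f x + g x :: nat)"
  unfolding recursive_def by (drule (1) total_recursive_add) simp

lemma recursive_mult: "recursive f \<Longrightarrow> recursive g \<Longrightarrow> recursive (\<lambda>x. f x * g x :: nat)"
  unfolding recursive_def by (drule (1) total_recursive_mult) simp

lemma recursive_diff: "recursive f \<Longrightarrow> recursive g \<Longrightarrow> recursive (\<lambda>x. f x - g x :: nat)"
  unfolding recursive_def by (drule (1) total_recursive_diff) simp

lemmas recursive_intros =
  recursive_id recursive_const recursive_Pair recursive_fst recursive_snd recursive_enc recursive_dec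
  recursive_Suc recursive_add recursive_mult recursive_diff

text \<open>The bridge by which bounded quantifiers and minimisation pass from argument lists to
  pairs.\<close>

lemma recursive_curry_iff:
  "recursive q \<longleftrightarrow> total_recursive 2 (\<lambda>xs. enc (q (dec (xs ! 0), dec (xs ! 1))))"
proof
  assume "recursive q"
  moreover have "total_recursive 2 (\<lambda>xs. prod_encode (xs ! 0, xs ! 1))"
    by (intro total_recursive_prod_encode total_recursive_nth) simp_all
  ultimately show "total_recursive 2 (\<lambda>xs. enc (q (dec (xs ! 0), dec (xs ! 1))))"
    unfolding recursive_def using total_recursive_comp1[of "\<lambda>xs. enc (q (dec (hd xs)))" 2]
    by (fastforce simp: dec_prod)
next
  assume "total_recursive 2 (\<lambda>xs. enc (q (dec (xs ! 0), dec (xs ! 1))))"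
  from total_recursive_comp2[OF this total_recursive_prod_decode]
  show "recursive q" by (simp add: recursive_def dec_prod)
qed

lemma recursive_bex:
  fixes q :: "nat \<times> 'a::coded \<Rightarrow> nat"
  assumes "recursive q"
  shows "\<exists>q'. recursive q' \<and> (\<forall>n x. q' (n, x) = (0::nat) \<longleftrightarrow> (\<exists>i<n. q (i, x) = 0))"
proof -
  have "total_recursive (Suc 1) (\<lambda>xs. q (xs ! 0, dec (xs ! 1)))"
    using assms by (simp add: recursive_curry_iff numeral_2_eq_2)
  from total_recursive_bex[OF this] obtain q' where q': "total_recursive (Suc 1) q'"
    "\<forall>n xs. q' (n # xs) = 0 \<longleftrightarrow> (\<exists>i<n. q (i, dec (xs ! 0)) = 0)"
    by (simp only: nth_Cons_0 nth_Cons_Suc One_nat_def) blast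
  from q'(1)[unfolded Suc_1] have "total_recursive 2 (\<lambda>xs. q' [xs ! 0, xs ! 1])"
    by (rule total_recursive_cong) (auto simp: length_Suc_conv numeral_2_eq_2)
  hence "recursive (\<lambda>z. q' [fst z, enc (snd z :: 'a)])" by (simp add: recursive_curry_iff)
  with q'(2) show ?thesis by (intro exI conjI) auto
qed

lemma recursive_ball:
  fixes q :: "nat \<times> 'a::coded \<Rightarrow> nat"
  assumes "recursive q"
  shows "\<exists>q'. recursive q' \<and> (\<forall>n x. q' (n, x) = (0::nat) \<longleftrightarrow> (\<forall>i<n. q (i, x) = 0))"
proof -
  have "total_recursive (Suc 1) (\<lambda>xs. q (xs ! 0, dec (xs ! 1)))"
    using assms by (simp add: recursive_curry_iff numeral_2_eq_2)
  from total_recursive_ball[OF this] obtain q' where q': "total_recursive (Suc 1) q'"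
    "\<forall>n xs. q' (n # xs) = 0 \<longleftrightarrow> (\<forall>i<n. q (i, dec (xs ! 0)) = 0)"
    by (simp only: nth_Cons_0 nth_Cons_Suc One_nat_def) blast
  from q'(1)[unfolded Suc_1] have "total_recursive 2 (\<lambda>xs. q' [xs ! 0, xs ! 1])"
    by (rule total_recursive_cong) (auto simp: length_Suc_conv numeral_2_eq_2)
  hence "recursive (\<lambda>z. q' [fst z, enc (snd z :: 'a)])" by (simp add: recursive_curry_iff)
  with q'(2) show ?thesis by (intro exI conjI) auto
qed

lemma recursive_Least:
  fixes q :: "nat \<times> 'a::coded \<Rightarrow> nat"
  assumes "recursive q" and "\<And>x. \<exists>n. q (n, x) = 0"
  shows "recursive (\<lambda>x. LEAST n. q (n, x) = 0)"
proof -
  have "total_recursive (Suc 1) (\<lambda>xs. q (xs ! 0, dec (xs ! 1)))"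
    using assms(1) by (simp add: recursive_curry_iff numeral_2_eq_2)
  from total_recursive_Least[OF this] assms(2)
  have "total_recursive 1 (\<lambda>xs. LEAST n. q (n, dec (xs ! 0)) = 0)" by simp
  thus ?thesis unfolding recursive_def by (elim total_recursive_cong) (auto simp: length_Suc_conv)
qed

text \<open>Normal form with a numerical witness. It makes the closure properties arithmetic; the
  link to halting computations is a single minimisation in \<open>uniformly_reI\<close>.\<close>

definition re :: "('a::coded \<Rightarrow> bool) \<Rightarrow> bool" where
  "re P \<longleftrightarrow> (\<exists>q. recursive q \<and> (\<forall>x. P x \<longleftrightarrow> (\<exists>n::nat. q (n, x) = (0::nat))))"

lemma reI: "recursive q \<Longrightarrow> (\<And>x. P x \<longleftrightarrow> (\<exists>n::nat. q (n, x) = (0::nat))) \<Longrightarrow> re P"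
  unfolding re_def by blast

lemma reE:
  assumes "re P"
  obtains q where "recursive q" and "\<And>x. P x \<longleftrightarrow> (\<exists>n::nat. q (n, x) = (0::nat))"
  using assms unfolding re_def by blast

lemma re_comp:
  assumes "re P" "recursive f"
  shows "re (\<lambda>x. P (f x))"
  using assms(1)
proof (rule reE)
  fix q assume q: "recursive q"
    "\<And>x. P x \<longleftrightarrow> (\<exists>n::nat. q (n, x) = (0::nat))"
  show ?thesis
    by (rule reI[where q = "\<lambda>z. q (fst z, f (snd z))"])
      (auto simp: q(2) intro!: recursive_comp[OF q(1)] recursive_intros recursive_comp[OF assms(2)])
qed

lemma re_eq_zero: "recursive f \<Longrightarrow> re (\<lambda>x. f x = (0::nat))"
  by (rule reI[where q = "\<lambda>z. f (snd z)"]) (auto intro!: recursive_intros elim: recursive_comp)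

lemma re_eq:
  assumes "recursive f" "recursive g"
  shows "re (\<lambda>x. f x = g x)"
proof -
  have "re (\<lambda>x. (enc (f x) - enc (g x)) + (enc (g x) - enc (f x)) = 0)"
    using assms by (intro re_eq_zero recursive_add recursive_diff recursive_enc)
  moreover have "a - b + (b - a) = 0 \<longleftrightarrow> a = b" for a b :: nat by auto
  ultimately show ?thesis by (simp only: enc_eq_iff)
qed

lemma re_less: "recursive f \<Longrightarrow> recursive g \<Longrightarrow> re (\<lambda>x. f x < (g x :: nat))"
  using re_eq_zero[of "\<lambda>x. Suc (f x) - g x"] recursive_diff[OF recursive_Suc]
  by (auto simp: Suc_le_eq)

lemma re_const: "re (\<lambda>x. P)"
  by (rule reI[where q = "\<lambda>z. if P then 0 else 1"]) (auto intro: recursive_const)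

text \<open>The two witnesses are packed into one number, and with zero for truth a sum expresses
  conjunction.\<close>

lemma re_conj:
  assumes "re P" "re Q"
  shows "re (\<lambda>x. P x \<and> Q x)"
  using assms(1)
proof (rule reE)
  fix p assume p: "recursive p"
    "\<And>x. P x \<longleftrightarrow> (\<exists>n::nat. p (n, x) = (0::nat))"
  show ?thesis using assms(2)
  proof (rule reE)
    fix q assume q: "recursive q"
      "\<And>x. Q x \<longleftrightarrow> (\<exists>n::nat. q (n, x) = (0::nat))"
    show ?thesis
    proof (rule reI)
      show "recursive (\<lambda>z. p (fst (dec (fst z) :: nat \<times> nat), snd z) + q (snd (dec (fst z) :: nat \<times> nat), snd z))"
        by (intro recursive_intros recursive_comp[OF p(1)] recursive_comp[OF q(1)])
      show "P x \<and> Q x \<longleftrightarrow> (\<exists>n. p (fst (dec (fst (n, x)) :: nat \<times> nat), snd (n, x)) +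
          q (snd (dec (fst (n, x)) :: nat \<times> nat), snd (n, x)) = 0)" for x
        unfolding p(2) q(2) by (auto intro: exI[of _ "enc (_ :: nat \<times> nat)"])
          (metis dec_enc fst_conv snd_conv)
    qed
  qed
qed

lemma re_disj:
  assumes "re P" "re Q"
  shows "re (\<lambda>x. P x \<or> Q x)"
  using assms(1)
proof (rule reE)
  fix p assume p: "recursive p"
    "\<And>x. P x \<longleftrightarrow> (\<exists>n::nat. p (n, x) = (0::nat))"
  show ?thesis using assms(2)
  proof (rule reE)
    fix q assume q: "recursive q"
      "\<And>x. Q x \<longleftrightarrow> (\<exists>n::nat. q (n, x) = (0::nat))"
    show ?thesis
    proof (rule reI)
      show "recursive (\<lambda>z. p (fst z, snd z) * q (fst z, snd z))"
        by (intro recursive_intros recursive_comp[OF p(1)] recursive_comp[OF q(1)])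
    qed (auto simp: p(2) q(2))
  qed
qed

lemma re_ex:
  fixes P :: "'a::coded \<Rightarrow> 'b::coded \<Rightarrow> bool"
  assumes "re (\<lambda>z. P (fst z) (snd z))"
  shows "re (\<lambda>x. \<exists>y. P x y)"
  using assms
proof (rule reE)
  fix p assume p: "recursive p"
    "\<And>z. P (fst z) (snd z) \<longleftrightarrow> (\<exists>n::nat. p (n, z) = (0::nat))"
  show ?thesis
  proof (rule reI)
    show "recursive (\<lambda>z. p (fst (dec (fst z) :: nat \<times> 'b), snd z, snd (dec (fst z) :: nat \<times> 'b)))"
      by (intro recursive_intros recursive_comp[OF p(1)])
    show "(\<exists>y. P x y) \<longleftrightarrow> (\<exists>n. p (fst (dec (fst (n, x)) :: nat \<times> 'b), snd (n, x), snd (dec (fst (n, x)) :: nat \<times> 'b)) = 0)" for x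
      using p(2)[of "(x, _)"] by auto (metis dec_enc fst_conv snd_conv)
  qed
qed

text \<open>Collection: the finitely many witnesses have a common bound, for instance one more than
  their sum. Searching for that bound leaves only bounded quantifiers.\<close>

lemma re_ball_less:
  fixes P :: "'a::coded \<Rightarrow> nat \<Rightarrow> bool"
  assumes "re (\<lambda>z. P (fst z) (snd z))" "recursive f"
  shows "re (\<lambda>x. \<forall>i<f x. P x i)"
  using assms(1)
proof (rule reE)
  fix p assume p: "recursive p"
    "\<And>z. P (fst z) (snd z) \<longleftrightarrow> (\<exists>n::nat. p (n, z) = (0::nat))"
  have "recursive (\<lambda>z::nat \<times> nat \<times> nat \<times> 'a. p (fst z, snd (snd (snd z)), fst (snd z)))"
    by (intro recursive_intros recursive_comp[OF p(1)])
  from recursive_bex[OF this] obtain q where q: "recursive q"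
    "\<And>w (z :: nat \<times> nat \<times> 'a). q (w, z) = (0::nat) \<longleftrightarrow> (\<exists>n<w. p (n, snd (snd z), fst z) = 0)"
    by (simp only: fst_conv snd_conv) blast
  have "recursive (\<lambda>z::nat \<times> nat \<times> 'a. q (fst (snd z), fst z, fst (snd z), snd (snd z)))"
    by (intro recursive_comp[OF q(1)] recursive_intros)
  from recursive_ball[OF this] obtain r where r: "recursive r"
    "\<And>k (z :: nat \<times> 'a). r (k, z) = (0::nat) \<longleftrightarrow> (\<forall>i<k. q (fst z, i, fst z, snd z) = 0)"
    by (simp only: fst_conv snd_conv) blast
  show ?thesis
  proof (rule reI)
    show "recursive (\<lambda>z. r (f (snd z), fst z, snd z))"
      by (intro recursive_comp[OF r(1)] recursive_comp[OF assms(2)] recursive_intros)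
    show "(\<forall>i<f x. P x i) \<longleftrightarrow> (\<exists>w. r (f (snd (w, x)), fst (w, x), snd (w, x)) = 0)" for x
    proof -
      have P: "P x i \<longleftrightarrow> (\<exists>n. p (n, x, i) = 0)" for i using p(2)[of "(x, i)"] by simp
      have "(\<forall>i<k. P x i) \<longleftrightarrow> (\<exists>w. \<forall>i<k. \<exists>n<w. p (n, x, i) = 0)" for k
      proof
        assume "\<forall>i<k. P x i"
        then obtain n where n: "\<And>i. i < k \<Longrightarrow> p (n i, x, i) = 0" unfolding P by metis
        have "n i < Suc (\<Sum>i<k. n i)" if "i < k" for i
          using member_le_sum[of i "{..<k}" n] that by simp
        with n show "\<exists>w. \<forall>i<k. \<exists>n<w. p (n, x, i) = 0" by blast
      qed (use P in blast)
      thus ?thesis by (simp add: q(2) r(2))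
    qed
  qed
qed

lemmas re_intros = re_eq re_less re_const re_conj re_disj re_ball_less re_ex recursive_intros

text \<open>Search for a pair of a witness and a value. Whichever pair is found first, its value is
  correct because the graph is single-valued, and totality makes the search end.\<close>

lemma recursive_graphI:
  fixes f :: "'a::coded \<Rightarrow> 'b::coded"
  assumes "re (\<lambda>z. snd z = f (fst z))"
  shows "recursive f"
  using assms
proof (rule reE)
  fix q assume q: "recursive q"
    "\<And>z. snd z = f (fst z) \<longleftrightarrow> (\<exists>n::nat. q (n, z) = (0::nat))"
  let ?q = "\<lambda>z. q (fst (dec (fst z) :: nat \<times> 'b), snd z, snd (dec (fst z) :: nat \<times> 'b))"
  have ex: "\<exists>n. ?q (n, x) = 0" for x
    using q(2)[of "(x, f x)"] by (auto, metis dec_enc fst_conv snd_conv)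
  have "recursive ?q" by (intro recursive_intros recursive_comp[OF q(1)])
  from recursive_Least[OF this ex]
  have "recursive (\<lambda>x. snd (dec (LEAST n. ?q (n, x) = 0) :: nat \<times> 'b))" by (intro recursive_intros)
  moreover have "snd (dec (LEAST n. ?q (n, x) = 0) :: nat \<times> 'b) = f x" for x
  proof -
    obtain n where "?q (n, x) = 0" using ex by blast
    from LeastI[of "\<lambda>n. ?q (n, x) = 0", OF this]
    show ?thesis using q(2)[of "(x, _)"] by auto
  qed
  ultimately show ?thesis by simp
qed

subsection \<open>Least fixed points\<close>

text \<open>Rules have exactly two premises; a rule with one premise uses it twice.\<close>

inductive derivable :: "('a \<Rightarrow> bool) \<Rightarrow> ('a \<Rightarrow> 'a \<Rightarrow> 'a \<Rightarrow> bool) \<Rightarrow> 'a \<Rightarrow> bool" for B R where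
  base: "B x \<Longrightarrow> derivable B R x"
| step: "R x y z \<Longrightarrow> derivable B R y \<Longrightarrow> derivable B R z \<Longrightarrow> derivable B R x"

definition derivation :: "('a \<Rightarrow> bool) \<Rightarrow> ('a \<Rightarrow> 'a \<Rightarrow> 'a \<Rightarrow> bool) \<Rightarrow> 'a list \<Rightarrow> bool" where
  "derivation B R xs \<longleftrightarrow>
     (\<forall>i<length xs. B (xs ! i) \<or> (\<exists>j<i. \<exists>k<i. R (xs ! i) (xs ! j) (xs ! k)))"

lemma derivation_append: "derivation B R xs \<Longrightarrow> derivation B R ys \<Longrightarrow> derivation B R (xs @ ys)"
  unfolding derivation_def
proof (intro allI impI)
  fix i
  assume xs: "\<forall>i<length xs. B (xs ! i) \<or> (\<exists>j<i. \<exists>k<i. R (xs ! i) (xs ! j) (xs ! k))"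
    and ys: "\<forall>i<length ys. B (ys ! i) \<or> (\<exists>j<i. \<exists>k<i. R (ys ! i) (ys ! j) (ys ! k))"
    and i: "i < length (xs @ ys)"
  show "B ((xs @ ys) ! i) \<or> (\<exists>j<i. \<exists>k<i. R ((xs @ ys) ! i) ((xs @ ys) ! j) ((xs @ ys) ! k))"
  proof (cases "i < length xs")
    case True
    thus ?thesis using xs by (fastforce simp: nth_append)
  next
    case False
    then obtain i' where i': "i = length xs + i'" "i' < length ys"
      using i by (metis add_diff_inverse_nat length_append nat_add_left_cancel_less)
    with ys consider "B (ys ! i')" | j k where "j < i'" "k < i'" "R (ys ! i') (ys ! j) (ys ! k)" by blast
    thus ?thesis
    proof cases
      case 2
      thus ?thesis using i'
        by (intro disjI2 exI[of _ "length xs + j"] conjI exI[of _ "length xs + k"]) auto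
    qed (use i' in simp)
  qed
qed

lemma derivation_snoc:
  "derivation B R xs \<Longrightarrow> B x \<or> (\<exists>y\<in>set xs. \<exists>z\<in>set xs. R x y z) \<Longrightarrow> derivation B R (xs @ [x])"
  unfolding derivation_def
proof (intro allI impI)
  fix i
  assume xs: "\<forall>i<length xs. B (xs ! i) \<or> (\<exists>j<i. \<exists>k<i. R (xs ! i) (xs ! j) (xs ! k))"
    and x: "B x \<or> (\<exists>y\<in>set xs. \<exists>z\<in>set xs. R x y z)" and i: "i < length (xs @ [x])"
  show "B ((xs @ [x]) ! i) \<or> (\<exists>j<i. \<exists>k<i. R ((xs @ [x]) ! i) ((xs @ [x]) ! j) ((xs @ [x]) ! k))"
  proof (cases "i < length xs")
    case True
    thus ?thesis using xs by (fastforce simp: nth_append)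
  next
    case False
    hence i: "i = length xs" using i by simp
    from x consider "B x" | j k where "j < i" "k < i" "R x (xs ! j) (xs ! k)"
      unfolding i by (metis in_set_conv_nth)
    thus ?thesis
    proof cases
      case 2
      thus ?thesis by (intro disjI2 exI[of _ j] conjI exI[of _ k]) (simp_all add: nth_append i)
    qed (simp add: i)
  qed
qed

text \<open>Derivation trees are flattened to sequences because sequences are what the beta function
  codes.\<close>

lemma derivable_iff_derivation: "derivable B R x \<longleftrightarrow> (\<exists>xs. derivation B R (xs @ [x]))"
proof
  assume "derivable B R x"
  thus "\<exists>xs. derivation B R (xs @ [x])"
  proof induction
    case (base x)
    thus ?case by (intro exI[of _ "[]"]) (simp add: derivation_def)
  next
    case (step x y z)
    then obtain ys zs where "derivation B R (ys @ [y])" "derivation B R (zs @ [z])" by blast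
    from derivation_append[OF this] have "derivation B R (((ys @ [y]) @ (zs @ [z])) @ [x])"
      by (rule derivation_snoc) (use step.hyps in auto)
    thus ?case by blast
  qed
next
  assume "\<exists>xs. derivation B R (xs @ [x])"
  then obtain xs where xs: "derivation B R (xs @ [x])" by blast
  have "derivable B R ((xs @ [x]) ! i)" if "i < length (xs @ [x])" for i
    using that
  proof (induction i rule: less_induct)
    case (less i)
    with xs consider "B ((xs @ [x]) ! i)"
      | j k where "j < i" "k < i" "R ((xs @ [x]) ! i) ((xs @ [x]) ! j) ((xs @ [x]) ! k)"
      unfolding derivation_def by blast
    thus ?case
      by cases (use less in \<open>auto intro: derivable.base derivable.step\<close>)
  qed
  from this[of "length xs"] show "derivable B R x" by simp
qed

section \<open>Coding derivations by the beta function\<close>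

lemma re_bt:
  assumes "recursive a" "recursive b" "recursive i" "recursive y"
  shows "re (\<lambda>x. bt (a x) (b x) (i x) = y x)"
proof -
  have "bt a b i = y \<longleftrightarrow> y < Suc (Suc i * b) \<and> (\<exists>q. a = q * Suc (Suc i * b) + y)" for a b i y
    unfolding bt_def
    by (metis add.commute div_mult_mod_eq mod_less mod_less_divisor mod_mult_self3 zero_less_Suc)
  moreover have "re (\<lambda>x. y x < Suc (Suc (i x) * b x) \<and> (\<exists>q. a x = q * Suc (Suc (i x) * b x) + y x))"
    by (intro re_intros assms assms[THEN recursive_comp])
  ultimately show ?thesis by presburger
qed

text \<open>The derivation is given by \<open>a\<close> and \<open>b\<close>, with its last entry at
  position \<open>m\<close>. The only universal quantifier is bounded, so the right side is r.e. by
  the closure rules.\<close>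

lemma derivable_iff_bt:
  fixes B :: "'a::coded \<Rightarrow> bool"
  shows "derivable B R x \<longleftrightarrow> (\<exists>a b m. bt a b m = enc x \<and> (\<forall>i<Suc m. \<exists>y. bt a b i = enc y \<and>
    (B y \<or> (\<exists>j k u v. j < i \<and> k < i \<and> bt a b j = enc u \<and> bt a b k = enc v \<and> R y u v))))"
    (is "_ \<longleftrightarrow> ?r")
proof
  assume "derivable B R x"
  then obtain xs where xs: "derivation B R (xs @ [x])" by (auto simp: derivable_iff_derivation)
  obtain a b where ab: "\<forall>i\<le>length xs. bt a b i = enc ((xs @ [x]) ! i)"
    using beta_ex[of "length xs" "\<lambda>i. enc ((xs @ [x]) ! i)"] by blast
  show ?r
  proof (intro exI conjI allI impI)
    show "bt a b (length xs) = enc x" using ab by simp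
    fix i assume i: "i < Suc (length xs)"
    thus "bt a b i = enc ((xs @ [x]) ! i)" using ab by simp
    from i xs consider "B ((xs @ [x]) ! i)"
      | j k where "j < i" "k < i" "R ((xs @ [x]) ! i) ((xs @ [x]) ! j) ((xs @ [x]) ! k)"
      unfolding derivation_def by fastforce
    thus "B ((xs @ [x]) ! i) \<or> (\<exists>j k u v. j < i \<and> k < i \<and> bt a b j = enc u \<and> bt a b k = enc v \<and>
        R ((xs @ [x]) ! i) u v)"
    proof cases
      case 2
      with ab i show ?thesis
        by (intro disjI2 exI[of _ j] exI[of _ k] exI[of _ "(xs @ [x]) ! j"] exI[of _ "(xs @ [x]) ! k"]) auto
    qed simp
  qed
next
  assume ?r
  then obtain a b m where m: "bt a b m = enc x" and *: "\<And>i. i < Suc m \<Longrightarrow> \<exists>y. bt a b i = enc y \<and>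
    (B y \<or> (\<exists>j k u v. j < i \<and> k < i \<and> bt a b j = enc u \<and> bt a b k = enc v \<and> R y u v))" by blast
  have "bt a b i = enc y \<Longrightarrow> derivable B R y" if "i < Suc m" for i y
    using that
  proof (induction i arbitrary: y rule: less_induct)
    case (less i)
    from *[OF less.prems(2)] less.prems(1) consider "B y"
      | j k u v where "j < i" "k < i" "bt a b j = enc u" "bt a b k = enc v" "R y u v" by auto
    thus ?case
    proof cases
      case 2
      have "derivable B R u" by (rule less.IH[OF 2(1,3)]) (use 2 less.prems in simp)
      moreover have "derivable B R v" by (rule less.IH[OF 2(2,4)]) (use 2 less.prems in simp)
      ultimately show ?thesis using 2 by (blast intro: derivable.step)
    qed (rule derivable.base)
  qed
  thus "derivable B R x" using m by blast
qed

lemma re_derivable: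
  fixes B :: "'a::coded \<Rightarrow> bool"
  assumes B: "re B" and R: "re (\<lambda>w. R (fst w) (fst (snd w)) (snd (snd w)))"
  shows "re (derivable B R)"
proof -
  have R': "re (\<lambda>x. R (f x) (g x) (h x))"
    if "recursive f" "recursive g" "recursive h" for f g h :: "'x::coded \<Rightarrow> 'a"
    using re_comp[OF R, of "\<lambda>x. (f x, g x, h x)"] that by (simp add: recursive_intros)
  show ?thesis unfolding derivable_iff_bt by (intro re_intros re_bt re_comp[OF B] R')
qed

text \<open>A relation decreasing some measure has only one fixed point.\<close>

lemma re_fixpoint:
  fixes D :: "'a::coded \<Rightarrow> bool" and m :: "'a \<Rightarrow> nat"
  assumes "re B" and "re (\<lambda>w. R (fst w) (fst (snd w)) (snd (snd w)))"
    and fix_eq: "\<And>x. D x \<longleftrightarrow> B x \<or> (\<exists>y z. R x y z \<and> D y \<and> D z)"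
    and m: "\<And>x y z. R x y z \<Longrightarrow> m y < m x \<and> m z < m x"
  shows "re D"
proof -
  have "derivable B R x \<longleftrightarrow> D x" for x
  proof
    assume "derivable B R x"
    thus "D x" by induction (use fix_eq in blast)+
  next
    assume "D x"
    thus "derivable B R x"
    proof (induction "m x" arbitrary: x rule: less_induct)
      case less
      from less.prems fix_eq consider "B x" | y z where "R x y z" "D y" "D z" by blast
      thus ?case by cases (use m less.hyps in \<open>blast intro: derivable.intros\<close>)+
    qed
  qed
  hence "derivable B R = D" by blast
  thus ?thesis using re_derivable[OF assms(1,2)] by simp
qed

section \<open>Provability is recursively enumerable\<close>

instantiation tm :: coded
begin

text \<open>Apart from \<open>Zero\<close>, codes have the form \<open>4 * q + r\<close> with
  \<open>r\<close> from 1 to 4. Division of the predecessor by 4 recovers the constructor, which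
  makes the coding onto.\<close>

primrec enc_tm :: "tm \<Rightarrow> nat" where
  "enc_tm Zero = 0"
| "enc_tm (Var i) = 4 * i + 1"
| "enc_tm (Succ s) = 4 * enc_tm s + 2"
| "enc_tm (Add s t) = 4 * prod_encode (enc_tm s, enc_tm t) + 3"
| "enc_tm (Mul s t) = 4 * prod_encode (enc_tm s, enc_tm t) + 4"

instance
proof
  have mod4: "4 * a \<noteq> Suc (4 * b)" "Suc (4 * b) \<noteq> 4 * a" "4 * a \<noteq> Suc (Suc (4 * b))"
    "Suc (Suc (4 * b)) \<noteq> 4 * a" "4 * a \<noteq> 3 + 4 * b" "3 + 4 * b \<noteq> 4 * a" for a b :: nat
    by presburger+
  have "enc s = enc t \<Longrightarrow> s = t" for s t :: tm
  proof (induction s arbitrary: t)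
    case (Var i) thus ?case by (cases t) (auto simp: mod4)
  next
    case Zero thus ?case by (cases t) auto
  next
    case (Succ s) thus ?case by (cases t) (auto simp: mod4)
  next
    case (Add s1 s2) thus ?case by (cases t) (auto simp: mod4)
  next
    case (Mul s1 s2) thus ?case by (cases t) (auto simp: mod4)
  qed
  moreover have "\<exists>t :: tm. n = enc t" for n
  proof (induction n rule: less_induct)
    case (less n)
    show ?case
    proof (cases n)
      case 0
      thus ?thesis by (intro exI[of _ Zero]) simp
    next
      case (Suc k)
      define q where "q = k div 4"
      \<comment> \<open>Both components of the pair coded by \<open>q\<close> are at most
        \<open>q\<close>, so the induction hypothesis covers all subterms.\<close>
      have q: "q < n" and n: "n = 4 * q + k mod 4 + 1" using Suc by (auto simp: q_def)
      obtain a b where ab: "prod_decode q = (a, b)" by fastforce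
      hence pe: "q = prod_encode (a, b)" by (metis prod_decode_inverse)
      with le_prod_encode_1[of a b] le_prod_encode_2[of b a] q have "a < n" "b < n" by auto
      with less q obtain s u v :: tm where suv: "q = enc s" "a = enc u" "b = enc v" by metis
      have "k mod 4 < 4" by simp
      then consider "k mod 4 = 0" | "k mod 4 = 1" | "k mod 4 = 2" | "k mod 4 = 3" by linarith
      thus ?thesis
      proof cases
        case 1 thus ?thesis using n by (intro exI[of _ "Var q"]) simp
      next
        case 2 thus ?thesis using n suv by (intro exI[of _ "Succ s"]) simp
      next
        case 3 thus ?thesis using n pe suv by (intro exI[of _ "Add u v"]) simp
      next
        case 4 thus ?thesis using n pe suv by (intro exI[of _ "Mul u v"]) simp
      qed
    qed
  qed
  ultimately show "bij (enc :: tm \<Rightarrow> nat)" by (metis bijI injI surj_def)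
qed

end

instantiation fm :: coded
begin

primrec enc_fm :: "fm \<Rightarrow> nat" where
  "enc_fm Fls = 0"
| "enc_fm (Eq s t) = 3 * prod_encode (enc s, enc t) + 1"
| "enc_fm (Imp A B) = 3 * prod_encode (enc_fm A, enc_fm B) + 2"
| "enc_fm (All A) = 3 * enc_fm A + 3"

instance
proof
  have mod3: "3 * a \<noteq> Suc (3 * b)" "Suc (3 * b) \<noteq> 3 * a" "3 * a \<noteq> Suc (Suc (3 * b))"
    "Suc (Suc (3 * b)) \<noteq> 3 * a" for a b :: nat
    by presburger+
  have "enc A = enc B \<Longrightarrow> A = B" for A B :: fm
  proof (induction A arbitrary: B)
    case Fls thus ?case by (cases B) auto
  next
    case (Eq s t) thus ?case by (cases B) (auto simp: mod3)
  next
    case (Imp A1 A2) thus ?case by (cases B) (auto simp: mod3)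
  next
    case (All A) thus ?case by (cases B) (auto simp: mod3)
  qed
  moreover have "\<exists>A :: fm. n = enc A" for n
  proof (induction n rule: less_induct)
    case (less n)
    show ?case
    proof (cases n)
      case 0
      thus ?thesis by (intro exI[of _ Fls]) simp
    next
      case (Suc k)
      define q where "q = k div 3"
      have q: "q < n" and n: "n = 3 * q + k mod 3 + 1" using Suc by (auto simp: q_def)
      obtain a b where ab: "prod_decode q = (a, b)" by fastforce
      hence pe: "q = prod_encode (a, b)" by (metis prod_decode_inverse)
      with le_prod_encode_1[of a b] le_prod_encode_2[of b a] q have "a < n" "b < n" by auto
      with less q obtain A B C :: fm where ABC: "q = enc A" "a = enc B" "b = enc C" by metis
      have "k mod 3 < 3" by simp
      then consider "k mod 3 = 0" | "k mod 3 = 1" | "k mod 3 = 2" by linarith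
      thus ?thesis
      proof cases
        case 1 thus ?thesis using n pe by (intro exI[of _ "Eq (dec a) (dec b)"]) simp
      next
        case 2 thus ?thesis using n pe ABC by (intro exI[of _ "Imp B C"]) simp
      next
        case 3 thus ?thesis using n ABC by (intro exI[of _ "All A"]) simp
      qed
    qed
  qed
  ultimately show "bij (enc :: fm \<Rightarrow> nat)" by (metis bijI injI surj_def)
qed

end

lemma recursive_prod_encode:
  "recursive f \<Longrightarrow> recursive g \<Longrightarrow> recursive (\<lambda>x. prod_encode (f x, g x))"
  using recursive_enc[OF recursive_Pair, of f g] by simp

lemma recursive_tm:
  "recursive f \<Longrightarrow> recursive (\<lambda>x. Var (f x))"
  "recursive s \<Longrightarrow> recursive (\<lambda>x. Succ (s x))"
  "recursive s \<Longrightarrow> recursive t \<Longrightarrow> recursive (\<lambda>x. Add (s x) (t x))"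
  "recursive s \<Longrightarrow> recursive t \<Longrightarrow> recursive (\<lambda>x. Mul (s x) (t x))"
  by (rule recursive_enc_iff[THEN iffD1], unfold enc_tm.simps,
      intro recursive_intros recursive_prod_encode; assumption)+

lemma recursive_fm:
  "recursive s \<Longrightarrow> recursive t \<Longrightarrow> recursive (\<lambda>x. Eq (s x) (t x))"
  "recursive A \<Longrightarrow> recursive B \<Longrightarrow> recursive (\<lambda>x. Imp (A x) (B x))"
  "recursive A \<Longrightarrow> recursive (\<lambda>x. All (A x))"
  by (rule recursive_enc_iff[THEN iffD1], unfold enc_fm.simps,
      intro recursive_intros recursive_prod_encode; assumption)+

lemmas syntax_intros = re_intros recursive_tm recursive_fm

subsection \<open>Recursiveness of substitution\<close>

text \<open>The pattern for the syntactic operations below: structural recursion becomes a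
  fixed-point equation for the graph, with the size of the argument as decreasing measure.\<close>

lemma recursive_lift: "recursive f \<Longrightarrow> recursive (\<lambda>x. lift (f x))"
proof (erule recursive_comp[rotated], rule recursive_graphI)
  show "re (\<lambda>z. snd z = lift (fst z))"
  proof (rule re_fixpoint)
    show "re (\<lambda>z. (\<exists>i. z = (Var i, Var (Suc i))) \<or> z = (Zero, Zero))"
      by (intro syntax_intros)
    let ?R = "\<lambda>x y z. (\<exists>s s'. x = (Succ s, Succ s') \<and> y = (s, s') \<and> z = (s, s')) \<or>
      (\<exists>s s' t t'. x = (Add s t, Add s' t') \<and> y = (s, s') \<and> z = (t, t')) \<or>
      (\<exists>s s' t t'. x = (Mul s t, Mul s' t') \<and> y = (s, s') \<and> z = (t, t'))"
    show "re (\<lambda>w. ?R (fst w) (fst (snd w)) (snd (snd w)))"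
      by (intro syntax_intros)
    show "snd z = lift (fst z) \<longleftrightarrow> ((\<exists>i. z = (Var i, Var (Suc i))) \<or> z = (Zero, Zero)) \<or>
        (\<exists>x y. ?R z x y \<and> snd x = lift (fst x) \<and> snd y = lift (fst y))" for z
      by (cases z, cases "fst z") (auto simp: lift_def)
    show "?R x y z \<Longrightarrow> size (fst y) < size (fst x) \<and> size (fst z) < size (fst x)" for x y z
      by auto
  qed
qed

text \<open>This family covers all substitutions in the calculus: \<open>(0, t, 0)\<close> instantiates variable 0
  by \<open>t\<close>, \<open>(0, Var 1, 2)\<close> lifts and \<open>(0, Succ (Var 0), 1)\<close> occurs in the induction axioms.\<close>

definition subst_of :: "nat \<times> tm \<times> nat \<Rightarrow> nat \<Rightarrow> tm" where
  "subst_of = (\<lambda>(k, t, d). (up ^^ k) (case_nat t (\<lambda>i. Var (i + d))))"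

lemma subst_of_simps [simp]:
  "subst_of (0, t, d) 0 = t"
  "subst_of (0, t, d) (Suc i) = Var (i + d)"
  "subst_of (Suc k, t, d) 0 = Var 0"
  "subst_of (Suc k, t, d) (Suc i) = lift (subst_of (k, t, d) i)"
  by (simp_all add: subst_of_def up_def)

text \<open>A function from \<open>nat\<close> to \<open>tm\<close> has no code, a triple has one.
  Closure of the family under \<open>up\<close> keeps the recursion of \<open>subst_fm\<close> among
  triples when it passes a quantifier.\<close>

lemma up_subst_of: "up (subst_of (k, t, d)) = subst_of (Suc k, t, d)"
  by (simp add: subst_of_def)

lemma recursive_subst_of: "recursive f \<Longrightarrow> recursive g \<Longrightarrow> recursive (\<lambda>x. subst_of (f x) (g x))"
proof -
  have "recursive (\<lambda>z. subst_of (fst z) (snd z))"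
  proof (rule recursive_graphI, rule re_fixpoint)
    let ?B = "\<lambda>z. (\<exists>t d. z = (((0, t, d), 0), t)) \<or> (\<exists>t d i. z = (((0, t, d), Suc i), Var (i + d))) \<or>
      (\<exists>k t d. z = (((Suc k, t, d), 0), Var 0))"
    show "re ?B" by (intro syntax_intros)
    let ?R = "\<lambda>x y z. \<exists>k t d i u. x = (((Suc k, t, d), Suc i), lift u) \<and> y = (((k, t, d), i), u) \<and> z = y"
    show "re (\<lambda>w. ?R (fst w) (fst (snd w)) (snd (snd w)))"
      by (intro syntax_intros recursive_lift)
    show "snd z = subst_of (fst (fst z)) (snd (fst z)) \<longleftrightarrow> ?B z \<or>
        (\<exists>x y. ?R z x y \<and> snd x = subst_of (fst (fst x)) (snd (fst x)) \<and> snd y = subst_of (fst (fst y)) (snd (fst y)))" for z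
    proof -
      obtain k t d i u where z: "z = (((k, t, d), i), u)" by (metis prod.collapse)
      show ?thesis unfolding z by (cases k; cases i) auto
    qed
    show "?R x y z \<Longrightarrow> fst (fst (fst y)) < fst (fst (fst x)) \<and> fst (fst (fst z)) < fst (fst (fst x))" for x y z
      by auto
  qed
  thus "recursive f \<Longrightarrow> recursive g \<Longrightarrow> recursive (\<lambda>x. subst_of (f x) (g x))"
    using recursive_comp[of "\<lambda>z. subst_of (fst z) (snd z)" "\<lambda>x. (f x, g x)"] by (simp add: recursive_Pair)
qed

lemma recursive_subst_tm:
  "recursive f \<Longrightarrow> recursive g \<Longrightarrow> recursive (\<lambda>x. subst_tm (subst_of (f x)) (g x))"
proof -
  have "recursive (\<lambda>z. subst_tm (subst_of (fst z)) (snd z))"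
  proof (rule recursive_graphI, rule re_fixpoint)
    let ?B = "\<lambda>z. (\<exists>\<sigma> i. z = ((\<sigma>, Var i), subst_of \<sigma> i)) \<or> (\<exists>\<sigma>. z = ((\<sigma>, Zero), Zero))"
    show "re ?B" by (intro syntax_intros recursive_subst_of)
    let ?R = "\<lambda>x y z.
      (\<exists>\<sigma> s s'. x = ((\<sigma>, Succ s), Succ s') \<and> y = ((\<sigma>, s), s') \<and> z = ((\<sigma>, s), s')) \<or>
      (\<exists>\<sigma> s s' t t'. x = ((\<sigma>, Add s t), Add s' t') \<and> y = ((\<sigma>, s), s') \<and> z = ((\<sigma>, t), t')) \<or>
      (\<exists>\<sigma> s s' t t'. x = ((\<sigma>, Mul s t), Mul s' t') \<and> y = ((\<sigma>, s), s') \<and> z = ((\<sigma>, t), t'))"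
    show "re (\<lambda>w. ?R (fst w) (fst (snd w)) (snd (snd w)))"
      by (intro syntax_intros)
    show "snd z = subst_tm (subst_of (fst (fst z))) (snd (fst z)) \<longleftrightarrow> ?B z \<or>
        (\<exists>x y. ?R z x y \<and> snd x = subst_tm (subst_of (fst (fst x))) (snd (fst x)) \<and>
          snd y = subst_tm (subst_of (fst (fst y))) (snd (fst y)))" for z
    proof -
      obtain k t d s u where z: "z = (((k, t, d), s), u)" by (metis prod.collapse)
      show ?thesis unfolding z by (cases s) auto
    qed
    show "?R x y z \<Longrightarrow> size (snd (fst y)) < size (snd (fst x)) \<and> size (snd (fst z)) < size (snd (fst x))" for x y z
      by auto
  qed
  thus "recursive f \<Longrightarrow> recursive g \<Longrightarrow> recursive (\<lambda>x. subst_tm (subst_of (f x)) (g x))"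
    using recursive_comp[of "\<lambda>z. subst_tm (subst_of (fst z)) (snd z)" "\<lambda>x. (f x, g x)"] by (simp add: recursive_Pair)
qed

lemma recursive_subst_fm:
  "recursive f \<Longrightarrow> recursive g \<Longrightarrow> recursive (\<lambda>x. subst_fm (subst_of (f x)) (g x))"
proof -
  have "recursive (\<lambda>z. subst_fm (subst_of (fst z)) (snd z))"
  proof (rule recursive_graphI, rule re_fixpoint)
    let ?B = "\<lambda>z. (\<exists>\<sigma>. z = ((\<sigma>, Fls), Fls)) \<or>
      (\<exists>\<sigma> s t. z = ((\<sigma>, Eq s t), Eq (subst_tm (subst_of \<sigma>) s) (subst_tm (subst_of \<sigma>) t)))"
    show "re ?B" by (intro syntax_intros recursive_subst_tm)
    let ?R = "\<lambda>x y z.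
      (\<exists>\<sigma> A A' B B'. x = ((\<sigma>, Imp A B), Imp A' B') \<and> y = ((\<sigma>, A), A') \<and> z = ((\<sigma>, B), B')) \<or>
      (\<exists>k t d A A'. x = (((k, t, d), All A), All A') \<and> y = (((Suc k, t, d), A), A') \<and> z = y)"
    show "re (\<lambda>w. ?R (fst w) (fst (snd w)) (snd (snd w)))"
      by (intro syntax_intros)
    show "snd z = subst_fm (subst_of (fst (fst z))) (snd (fst z)) \<longleftrightarrow> ?B z \<or>
        (\<exists>x y. ?R z x y \<and> snd x = subst_fm (subst_of (fst (fst x))) (snd (fst x)) \<and>
          snd y = subst_fm (subst_of (fst (fst y))) (snd (fst y)))" for z
    proof -
      obtain k t d A A' where z: "z = (((k, t, d), A), A')" by (metis prod.collapse)
      show ?thesis unfolding z by (cases A) (auto simp: up_subst_of)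
    qed
    \<comment> \<open>Under a quantifier the component \<open>k\<close> grows; what decreases is the
      size of the formula.\<close>
    show "?R x y z \<Longrightarrow> size (snd (fst y)) < size (snd (fst x)) \<and> size (snd (fst z)) < size (snd (fst x))" for x y z
      by auto
  qed
  thus "recursive f \<Longrightarrow> recursive g \<Longrightarrow> recursive (\<lambda>x. subst_fm (subst_of (f x)) (g x))"
    using recursive_comp[of "\<lambda>z. subst_fm (subst_of (fst z)) (snd z)" "\<lambda>x. (f x, g x)"] by (simp add: recursive_Pair)
qed

lemma subst_of_eqs:
  "subst_of (0, t, 0) = case_nat t Var"
  "subst_of (0, Var 1, 2) = (\<lambda>i. Var (Suc i))"
  "subst_of (0, Succ (Var 0), 1) = case_nat (Succ (Var 0)) (\<lambda>i. Var (Suc i))"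
  by (auto simp: subst_of_def fun_eq_iff split: nat.split)

lemma recursive_inst: "recursive A \<Longrightarrow> recursive t \<Longrightarrow> recursive (\<lambda>x. inst (A x) (t x))"
  unfolding inst_def subst_of_eqs(1)[symmetric]
  by (intro recursive_subst_fm recursive_intros)

lemma recursive_lift_fm: "recursive A \<Longrightarrow> recursive (\<lambda>x. lift_fm (A x))"
  unfolding lift_fm_def subst_of_eqs(2)[symmetric]
  by (intro recursive_subst_fm recursive_intros)

lemma recursive_induction_ax: "recursive A \<Longrightarrow> recursive (\<lambda>x. induction_ax (A x))"
  unfolding induction_ax_def subst_of_eqs(3)[symmetric]
  by (intro recursive_subst_fm recursive_inst recursive_fm recursive_intros)

lemma re_PA: "recursive A \<Longrightarrow> re (\<lambda>x. A x \<in> PA)"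
  unfolding PA_def image_iff Un_iff insert_iff empty_iff bex_UNIV
  by (intro syntax_intros recursive_induction_ax) (simp_all add: recursive_comp recursive_intros)

text \<open>The parameter travels along the derivation together with the formula, and this yields an
  enumeration uniform in the theory.\<close>

lemma re_proves:
  fixes T :: "'p::coded \<Rightarrow> fm set"
  assumes "re (\<lambda>z. snd z \<in> T (fst z))"
  shows "re (\<lambda>z. T (fst z) \<turnstile> snd z)"
proof -
  let ?B = "\<lambda>x. snd x \<in> T (fst x) \<or> (\<exists>A B. snd x = Imp A (Imp B A)) \<or>
    (\<exists>A B C. snd x = Imp (Imp A (Imp B C)) (Imp (Imp A B) (Imp A C))) \<or>
    (\<exists>A. snd x = Imp (Neg (Neg A)) A) \<or> (\<exists>A t. snd x = Imp (All A) (inst A t)) \<or>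
    (\<exists>A B. snd x = Imp (All (Imp A B)) (Imp (All A) (All B))) \<or>
    (\<exists>A. snd x = Imp A (All (lift_fm A))) \<or> (\<exists>t. snd x = Eq t t) \<or>
    (\<exists>s t A. snd x = Imp (Eq s t) (Imp (inst A s) (inst A t)))"
  let ?R = "\<lambda>x y z. fst y = fst x \<and> fst z = fst x \<and>
    (snd y = Imp (snd z) (snd x) \<or> snd x = All (snd y) \<and> z = y)"
  have "re (derivable ?B ?R)"
    by (rule re_derivable) (intro syntax_intros assms recursive_inst recursive_lift_fm)+
  moreover have "derivable ?B ?R = (\<lambda>z. T (fst z) \<turnstile> snd z)"
  proof (intro ext iffI)
    fix z
    assume "derivable ?B ?R z"
    thus "T (fst z) \<turnstile> snd z"
    proof induction
      case (base x)
      thus ?case by (elim disjE exE) (auto intro: proves.intros(1-9))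
    next
      case (step x y z)
      thus ?case by (auto intro: MP Gen)
    qed
  next
    fix z
    have "derivable ?B ?R (p, A)" if "T p \<turnstile> A" for p A
      using that
    proof (induction rule: proves.induct)
      case (MP A B)
      show ?case by (rule derivable.step[OF _ MP.IH]) simp
    next
      case (Gen A)
      show ?case by (rule derivable.step[OF _ Gen.IH Gen.IH]) simp
    qed (rule derivable.base, simp, blast?)+
    from this[of "fst z" "snd z"] show "T (fst z) \<turnstile> snd z \<Longrightarrow> derivable ?B ?R z" by simp
  qed
  ultimately show ?thesis by (simp only:)
qed

subsection \<open>The axioms on prefixes of a string\<close>

lemma recursive_numeral_tm: "recursive f \<Longrightarrow> recursive (\<lambda>x. numeral_tm (f x))"
proof (erule recursive_comp[rotated], rule recursive_graphI, rule re_fixpoint)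
  show "re (\<lambda>z. z = (0, Zero))" by (intro syntax_intros)
  let ?R = "\<lambda>x y z. \<exists>n t. x = (Suc n, Succ t) \<and> y = (n, t) \<and> z = y"
  show "re (\<lambda>w. ?R (fst w) (fst (snd w)) (snd (snd w)))"
    by (intro syntax_intros)
  show "snd z = numeral_tm (fst z) \<longleftrightarrow> z = (0, Zero) \<or>
      (\<exists>x y. ?R z x y \<and> snd x = numeral_tm (fst x) \<and> snd y = numeral_tm (fst y))" for z
    by (cases z, cases "fst z") auto
  show "?R x y z \<Longrightarrow> fst y < fst x \<and> fst z < fst x" for x y z by auto
qed

text \<open>The formula is fixed and the substitution varies, so induction on the formula takes
  place outside the coding. This reaches \<open>inst2 \<Psi>\<close>, whose substitution of two
  terms is not covered by \<open>subst_of\<close>.\<close>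

lemma recursive_subst_fixed:
  shows "(\<And>i. recursive (\<lambda>x. \<sigma> x i)) \<Longrightarrow> recursive (\<lambda>x. subst_fm (\<sigma> x) A)"
proof (induction A arbitrary: \<sigma>)
  case (Eq s t)
  have "recursive (\<lambda>x. subst_tm (\<sigma> x) u)" for u
    by (induction u) (auto intro: syntax_intros Eq)
  thus ?case by (auto intro: syntax_intros)
next
  case (All A)
  have "recursive (\<lambda>x. up (\<sigma> x) i)" for i
    by (cases i) (auto simp: up_def intro: syntax_intros recursive_lift All)
  from All.IH[OF this] show ?case by (simp add: recursive_fm)
qed (auto intro: syntax_intros)

lemma recursive_K_ge_fm:
  assumes "recursive x" "recursive n" "recursive c"
  shows "recursive (\<lambda>z. K_ge_fm \<Psi> (x z) (n z) (c z))"
proof -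
  have "recursive (\<lambda>z. inst2 \<Psi> (Var 1) (lift (lift (x z))))"
    unfolding inst2_def
  proof (rule recursive_subst_fixed)
    show "recursive (\<lambda>z. case_nat (Var 1) (case_nat (lift (lift (x z))) Var) i)" for i
      by (cases i; cases "i - 1") (auto intro: recursive_const recursive_lift[OF recursive_lift[OF assms(1)]])
  qed
  thus ?thesis unfolding K_ge_fm_def le_fm_def
    by (intro syntax_intros recursive_lift assms)
qed

lemma inv_code [simp]: "inv code (code s) = s"
  using bij_code by (simp add: bij_is_inj)

text \<open>Appending a bit sends the code \<open>n\<close> to \<open>2 * n + 1\<close> or
  \<open>2 * n + 2\<close>. This is the recursion on codes for length and prefix.\<close>

lemma inv_code_simps [simp]:
  "inv code 0 = []"
  "inv code (Suc (2 * n)) = inv code n @ [False]"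
  "inv code (Suc (Suc (2 * n))) = inv code n @ [True]"
proof -
  obtain s where s: "n = code s" using bij_code by (metis bij_pointE)
  show "inv code 0 = []" using inv_code[of "[]"] by (simp add: code_Nil)
  show "inv code (Suc (2 * n)) = inv code n @ [False]"
    using inv_code[of "s @ [False]"] by (simp add: code_snoc s)
  show "inv code (Suc (Suc (2 * n))) = inv code n @ [True]"
    using inv_code[of "s @ [True]"] by (simp add: code_snoc s)
qed

lemma recursive_length_inv_code: "recursive f \<Longrightarrow> recursive (\<lambda>x. length (inv code (f x)))"
proof (erule recursive_comp[rotated], rule recursive_graphI, rule re_fixpoint)
  show "re (\<lambda>z. z = (0, 0))" by (intro syntax_intros)
  let ?R = "\<lambda>x y z. \<exists>n l. (x = (Suc (2 * n), Suc l) \<or> x = (Suc (Suc (2 * n)), Suc l)) \<and> y = (n, l) \<and> z = y"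
  show "re (\<lambda>w. ?R (fst w) (fst (snd w)) (snd (snd w)))"
    by (intro syntax_intros)
  show "snd z = length (inv code (fst z)) \<longleftrightarrow> z = (0, 0) \<or>
      (\<exists>x y. ?R z x y \<and> snd x = length (inv code (fst x)) \<and> snd y = length (inv code (fst y)))" for z
  proof -
    consider l where "z = (0, l)" | n l where "z = (Suc (2 * n), l)" | n l where "z = (Suc (Suc (2 * n)), l)"
      by (metis prod.collapse not0_implies_Suc oddE evenE Suc_eq_plus1 mult_Suc_right add_2_eq_Suc mult_0_right)
    thus ?thesis by cases (auto simp: Suc_double_not_eq_double double_not_eq_Suc_double)
  qed
  show "?R x y z \<Longrightarrow> fst y < fst x \<and> fst z < fst x" for x y z by auto
qed

text \<open>Recursion peels off the last bit of the longer string: a prefix of it is either the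
  whole string or a prefix of what remains.\<close>

lemma re_prefix_inv_code:
  "recursive f \<Longrightarrow> recursive g \<Longrightarrow> re (\<lambda>x. prefix (inv code (f x)) (inv code (g x)))"
proof -
  have "re (\<lambda>z. prefix (inv code (fst z)) (inv code (snd z)))"
  proof (rule re_fixpoint)
    show "re (\<lambda>z. fst z = snd z)" by (intro syntax_intros)
    let ?R = "\<lambda>x y z. \<exists>t s. (x = (t, Suc (2 * s)) \<or> x = (t, Suc (Suc (2 * s)))) \<and> y = (t, s) \<and> z = y"
    show "re (\<lambda>w. ?R (fst w) (fst (snd w)) (snd (snd w)))"
      by (intro syntax_intros)
    have inj: "inv code m = inv code n \<longleftrightarrow> m = n" for m n
      using bij_code by (metis bij_inv_eq_iff)
    show "prefix (inv code (fst z)) (inv code (snd z)) \<longleftrightarrow> fst z = snd z \<or>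
        (\<exists>x y. ?R z x y \<and> prefix (inv code (fst x)) (inv code (snd x)) \<and>
          prefix (inv code (fst y)) (inv code (snd y)))" for z
    proof -
      consider t where "z = (t, 0)" | t n where "z = (t, Suc (2 * n))" | t n where "z = (t, Suc (Suc (2 * n)))"
        by (metis prod.collapse not0_implies_Suc oddE evenE Suc_eq_plus1 mult_Suc_right add_2_eq_Suc mult_0_right)
      thus ?thesis
      proof cases
        case 1
        thus ?thesis using inj[of _ 0] by simp
      next
        case (2 t n)
        thus ?thesis using inj[of t "Suc (2 * n)"]
          by (auto simp: Suc_double_not_eq_double double_not_eq_Suc_double)
      next
        case (3 t n)
        thus ?thesis using inj[of t "Suc (Suc (2 * n))"]
          by (auto simp: Suc_double_not_eq_double double_not_eq_Suc_double)
      qed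
    qed
    show "?R x y z \<Longrightarrow> snd y < snd x \<and> snd z < snd x" for x y z by auto
  qed
  thus "recursive f \<Longrightarrow> recursive g \<Longrightarrow> re (\<lambda>x. prefix (inv code (f x)) (inv code (g x)))"
    using re_comp[of "\<lambda>z. prefix (inv code (fst z)) (inv code (snd z))" "\<lambda>x. (f x, g x)"]
    by (simp add: recursive_Pair)
qed

text \<open>The part of \<open>MLR\<close> that a finite string determines. It is r.e. uniformly in
  \<open>c\<close> and \<open>s\<close>, and it grows with \<open>s\<close>.\<close>

definition MLR_prefix :: "fm \<Rightarrow> nat \<Rightarrow> bool list \<Rightarrow> fm set" where
  "MLR_prefix \<Psi> c s = PA \<union>
     {K_ge_fm \<Psi> (numeral_tm (code t)) (numeral_tm (length t)) (numeral_tm c) | t. prefix t s}"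

text \<open>Unbounded search for the witness halts exactly when there is one.\<close>

lemma uniformly_reI:
  assumes "re (\<lambda>z. inv code (snd z) \<in> W (fst z))"
  shows "uniformly_re W"
  using assms
proof (rule reE)
  fix q assume q: "recursive q" "\<And>z. inv code (snd z) \<in> W (fst z) \<longleftrightarrow> (\<exists>n::nat. q (n, z) = (0::nat))"
  have "total_recursive 3 (\<lambda>xs. prod_encode (xs ! 1, xs ! 2))"
    by (intro total_recursive_prod_encode total_recursive_nth) simp_all
  moreover have "total_recursive 3 (\<lambda>xs. xs ! 0)" by (rule total_recursive_nth) simp
  ultimately have "total_recursive 3 (\<lambda>xs. q (xs ! 0, xs ! 1, xs ! 2))"
    using total_recursive_comp2[OF q(1)[unfolded recursive_curry_iff],
        of 3 "\<lambda>xs. xs ! 0" "\<lambda>xs. prod_encode (xs ! 1, xs ! 2)"] by (simp add: dec_prod)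
  then obtain r where r: "\<And>xs y. length xs = 3 \<Longrightarrow> computes r xs y \<longleftrightarrow> y = q (xs ! 0, xs ! 1, xs ! 2)"
    unfolding total_recursive_def by blast
  have "s \<in> W n \<longleftrightarrow> (\<exists>y. computes (RMu r) [n, code s] y)" for n s
  proof -
    have "computes (RMu r) [n, code s] y \<longleftrightarrow> q (y, n, code s) = 0 \<and> (\<forall>m<y. q (m, n, code s) \<noteq> 0)" for y
      using computes_RMu[of r "[n, code s]" "\<lambda>xs. q (xs ! 0, xs ! 1, xs ! 2)" y] r by simp
    moreover have "s \<in> W n \<longleftrightarrow> (\<exists>y. q (y, n, code s) = 0)" using q(2)[of "(n, code s)"] by simp
    ultimately show ?thesis using exists_least_iff[of "\<lambda>y. q (y, n, code s) = 0"] by simp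
  qed
  thus "uniformly_re W" unfolding uniformly_re_def by blast
qed

lemma uniformly_re_MLR_prefix: "uniformly_re (\<lambda>c. {s. MLR_prefix \<Psi> c s \<turnstile> \<phi>})"
proof -
  let ?T = "\<lambda>z. MLR_prefix \<Psi> (fst z) (inv code (snd z))"
  \<comment> \<open>Strings are replaced by their codes so that all quantifiers range over coded
    types.\<close>
  have "snd z \<in> ?T (fst z) \<longleftrightarrow> snd z \<in> PA \<or> (\<exists>n. prefix (inv code n) (inv code (snd (fst z))) \<and>
      snd z = K_ge_fm \<Psi> (numeral_tm n) (numeral_tm (length (inv code n))) (numeral_tm (fst (fst z))))" for z
    unfolding MLR_prefix_def using bij_code by auto (metis inv_code, metis bij_inv_eq_iff)
  moreover have "re (\<lambda>z :: (nat \<times> nat) \<times> fm. snd z \<in> PA \<or> (\<exists>n. prefix (inv code n) (inv code (snd (fst z))) \<and>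
      snd z = K_ge_fm \<Psi> (numeral_tm n) (numeral_tm (length (inv code n))) (numeral_tm (fst (fst z)))))"
    by (intro syntax_intros re_PA re_prefix_inv_code recursive_K_ge_fm recursive_numeral_tm
        recursive_length_inv_code)
  ultimately have "re (\<lambda>z. snd z \<in> ?T (fst z))" by presburger
  from re_comp[OF re_proves[OF this], of "\<lambda>z. (z, \<phi>)"] have "re (\<lambda>z. ?T z \<turnstile> \<phi>)"
    by (simp add: recursive_intros)
  thus ?thesis by (intro uniformly_reI) simp
qed

section \<open>Substitution and provability\<close>

lemma subst_subst_tm: "subst_tm \<sigma> (subst_tm \<tau> t) = subst_tm (\<lambda>i. subst_tm \<sigma> (\<tau> i)) t"
  by (induction t) auto

lemma up_simps [simp]: "up \<sigma> 0 = Var 0" "up \<sigma> (Suc i) = lift (\<sigma> i)"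
  by (simp_all add: up_def)

lemma subst_up_lift: "subst_tm (up \<sigma>) (lift t) = lift (subst_tm \<sigma> t)"
  by (simp add: lift_def subst_subst_tm)

lemma subst_subst_fm: "subst_fm \<sigma> (subst_fm \<tau> A) = subst_fm (\<lambda>i. subst_tm \<sigma> (\<tau> i)) A"
proof (induction A arbitrary: \<sigma> \<tau>)
  case (All A)
  have "(\<lambda>i. subst_tm (up \<sigma>) (up \<tau> i)) = up (\<lambda>i. subst_tm \<sigma> (\<tau> i))"
    by (rule ext, rename_tac i, case_tac i) (simp_all add: subst_up_lift)
  with All show ?case by simp
qed (auto simp: subst_subst_tm)

lemma subst_tm_cong: "(\<And>i. i \<in> fv_tm t \<Longrightarrow> \<sigma> i = \<tau> i) \<Longrightarrow> subst_tm \<sigma> t = subst_tm \<tau> t"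
  by (induction t) auto

lemma subst_fm_cong: "(\<And>i. i \<in> fv A \<Longrightarrow> \<sigma> i = \<tau> i) \<Longrightarrow> subst_fm \<sigma> A = subst_fm \<tau> A"
proof (induction A arbitrary: \<sigma> \<tau>)
  case (Eq s t)
  thus ?case using subst_tm_cong[of s \<sigma> \<tau>] subst_tm_cong[of t \<sigma> \<tau>] by simp
next
  case (Imp A B)
  have "subst_fm \<sigma> A = subst_fm \<tau> A" by (rule Imp.IH(1)) (use Imp.prems in simp)
  moreover have "subst_fm \<sigma> B = subst_fm \<tau> B" by (rule Imp.IH(2)) (use Imp.prems in simp)
  ultimately show ?case by simp
next
  case (All A)
  have "up \<sigma> i = up \<tau> i" if "i \<in> fv A" for i
    using that All.prems by (cases i) auto
  with All.IH show ?case by (metis subst_fm.simps(4))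
qed simp

lemma subst_tm_Var [simp]: "subst_tm Var t = t"
  by (induction t) auto

lemma up_Var [simp]: "up Var = Var"
  by (rule ext, rename_tac i, case_tac i) (simp_all add: lift_def)

lemma subst_fm_Var [simp]: "subst_fm Var A = A"
  by (induction A) auto

lemma subst_lift: "subst_tm (case_nat u \<sigma>) (lift t) = subst_tm \<sigma> t"
  by (simp add: lift_def subst_subst_tm)

lemma inst_subst_up: "inst (subst_fm (up \<sigma>) A) t = subst_fm (case_nat t \<sigma>) A"
proof -
  have "(\<lambda>i. subst_tm (case_nat t Var) (up \<sigma> i)) = case_nat t \<sigma>"
    by (rule ext, rename_tac i, case_tac i) (simp_all add: subst_lift)
  thus ?thesis by (simp add: inst_def subst_subst_fm)
qed

lemma subst_inst: "subst_fm \<sigma> (inst A t) = inst (subst_fm (up \<sigma>) A) (subst_tm \<sigma> t)"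
proof -
  have "(\<lambda>i. subst_tm \<sigma> (case_nat t Var i)) = case_nat (subst_tm \<sigma> t) \<sigma>"
    by (rule ext, rename_tac i, case_tac i) simp_all
  thus ?thesis by (simp add: inst_subst_up) (simp add: inst_def subst_subst_fm)
qed

lemma subst_up_lift_fm: "subst_fm (up \<sigma>) (lift_fm A) = lift_fm (subst_fm \<sigma> A)"
  by (simp add: lift_fm_def subst_subst_fm lift_def)

lemma finite_fv_tm: "finite (fv_tm t)"
  by (induction t) auto

lemma finite_fv: "finite (fv A)"
proof (induction A)
  case (All A)
  have "{i. Suc i \<in> fv A} = Suc -` fv A" by auto
  with All show ?case by (simp add: finite_vimageI)
qed (auto simp: finite_fv_tm)

text \<open>Induction axioms may have free parameters. Substituting for these gives another
  induction axiom, so PA is closed under substitution, as the renaming of variables below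
  requires.\<close>

lemma subst_induction_ax: "subst_fm \<sigma> (induction_ax A) = induction_ax (subst_fm (up \<sigma>) A)"
proof -
  let ?s = "case_nat (Succ (Var 0)) (\<lambda>i. Var (Suc i))"
  \<comment> \<open>The two substitutions commute: one changes only variable 0, which the other
    fixes.\<close>
  have "(\<lambda>i. subst_tm (up \<sigma>) (?s i)) = (\<lambda>i. subst_tm ?s (up \<sigma> i))"
  proof
    show "subst_tm (up \<sigma>) (?s i) = subst_tm ?s (up \<sigma> i)" for i
      by (cases i) (simp_all add: subst_lift flip: lift_def)
  qed
  thus ?thesis by (simp add: induction_ax_def subst_inst subst_subst_fm)
qed

lemma subst_PA: "A \<in> PA \<Longrightarrow> subst_fm \<sigma> A \<in> PA"
  unfolding PA_def by (auto simp: subst_induction_ax lift_def)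

lemma proves_subst:
  assumes T: "\<And>\<sigma> A. A \<in> T \<Longrightarrow> subst_fm \<sigma> A \<in> T"
  shows "T \<turnstile> A \<Longrightarrow> T \<turnstile> subst_fm \<sigma> A"
proof (induction arbitrary: \<sigma> rule: proves.induct)
  case (MP A B)
  from MP.IH(1)[of \<sigma>] MP.IH(2)[of \<sigma>] show ?case by (simp add: proves.MP)
qed (auto simp: subst_inst subst_up_lift_fm intro: T proves.intros(1-9) Gen)

section \<open>Completeness\<close>

text \<open>\<open>Gen\<close> does not apply to the hypotheses \<open>G\<close>, so the deduction theorem has no side condition.\<close>

inductive entails :: "fm set \<Rightarrow> fm set \<Rightarrow> fm \<Rightarrow> bool" for T G where
  hyp: "A \<in> G \<Longrightarrow> entails T G A"
| prv: "T \<turnstile> A \<Longrightarrow> entails T G A"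
| mp: "entails T G (Imp A B) \<Longrightarrow> entails T G A \<Longrightarrow> entails T G B"

lemma entails_mono: "entails T G A \<Longrightarrow> G \<subseteq> H \<Longrightarrow> entails T H A"
  by (induction rule: entails.induct) (auto intro: entails.intros)

lemma entails_empty: "entails T {} A \<Longrightarrow> T \<turnstile> A"
  by (induction rule: entails.induct) (auto intro: MP)

lemma entails_finite: "entails T G A \<Longrightarrow> \<exists>F. finite F \<and> F \<subseteq> G \<and> entails T F A"
proof (induction rule: entails.induct)
  case (hyp A)
  thus ?case by (intro exI[of _ "{A}"]) (auto intro: entails.hyp)
next
  case (prv A)
  thus ?case by (intro exI[of _ "{}"]) (auto intro: entails.prv)
next
  case (mp A B)
  then obtain F F' where "finite F" "F \<subseteq> G" "entails T F (Imp A B)" "finite F'" "F' \<subseteq> G" "entails T F' A"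
    by blast
  thus ?case
    by (intro exI[of _ "F \<union> F'"]) (auto intro: entails.mp[of _ _ A] entails_mono)
qed

lemma entails_Imp: "entails T (insert A G) B \<Longrightarrow> entails T G (Imp A B)"
proof (induction rule: entails.induct)
  case (hyp B)
  show ?case
  proof (cases "B = A")
    case True
    have "T \<turnstile> Imp A A" using S[of T A "Imp A A" A] K[of T A] by (metis MP)
    with True show ?thesis by (auto intro: entails.prv)
  next
    case False
    with hyp show ?thesis by (auto intro: entails.mp[OF entails.prv[OF K]] entails.hyp)
  qed
next
  case (prv B)
  thus ?case by (auto intro: entails.prv MP[OF K])
next
  case (mp B C)
  show ?case by (rule entails.mp[OF entails.mp[OF entails.prv[OF S]]]) fact+
qed

lemma entails_Fls: "entails T G Fls \<Longrightarrow> entails T G A"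
  by (rule entails.mp[OF entails.prv[OF DN]]) (rule entails.mp[OF entails.prv[OF K]])

lemma entails_contr: "entails T (insert (Neg A) G) Fls \<Longrightarrow> entails T G A"
  by (rule entails.mp[OF entails.prv[OF DN]]) (rule entails_Imp)

lemma entails_subst:
  assumes T: "\<And>\<sigma> A. A \<in> T \<Longrightarrow> subst_fm \<sigma> A \<in> T"
  shows "entails T G A \<Longrightarrow> entails T (subst_fm \<sigma> ` G) (subst_fm \<sigma> A)"
proof (induction rule: entails.induct)
  case (mp A B)
  thus ?case by (auto intro: entails.mp)
qed (auto intro: entails.intros proves_subst[OF T])

text \<open>Lifted hypotheses do not mention variable 0, so \<open>Vac\<close> quantifies them,
  \<open>Gen\<close> quantifies theorems of \<open>T\<close>, and \<open>Dist\<close> carries the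
  quantifier through modus ponens.\<close>

lemma entails_lift_All: "entails T (lift_fm ` G) A \<Longrightarrow> entails T G (All A)"
proof (induction rule: entails.induct)
  case (hyp A)
  thus ?case by (auto intro: entails.mp[OF entails.prv[OF Vac]] entails.hyp)
next
  case (prv A)
  thus ?case by (auto intro: entails.prv Gen)
next
  case (mp A B)
  show ?case by (rule entails.mp[OF entails.mp[OF entails.prv[OF Dist]]]) fact+
qed

text \<open>The substitution \<open>\<rho>\<close> renames \<open>k\<close> to 0 and shifts all
  other variables. On hypotheses without \<open>k\<close> it is lifting, and it turns
  \<open>inst A (Var k)\<close> back into \<open>A\<close>.\<close>

lemma entails_fresh:
  assumes T: "\<And>\<sigma> A. A \<in> T \<Longrightarrow> subst_fm \<sigma> A \<in> T"
    and k: "\<And>B. B \<in> insert (All A) G \<Longrightarrow> k \<notin> fv B"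
    and A: "entails T G (inst A (Var k))"
  shows "entails T G (All A)"
proof -
  define \<rho> where "\<rho> i = (if i = k then Var 0 else Var (Suc i))" for i
  have "subst_fm \<rho> B = lift_fm B" if "B \<in> G" for B
    unfolding lift_fm_def by (rule subst_fm_cong) (use k[of B] that in \<open>auto simp: \<rho>_def\<close>)
  hence "subst_fm \<rho> ` G = lift_fm ` G" by simp
  moreover have "subst_fm \<rho> (inst A (Var k)) = A"
  proof -
    have "subst_fm \<rho> (inst A (Var k)) = subst_fm (\<lambda>i. subst_tm \<rho> (case_nat (Var k) Var i)) A"
      by (simp add: inst_def subst_subst_fm)
    also have "\<dots> = subst_fm Var A"
    proof (rule subst_fm_cong)
      fix i assume "i \<in> fv A"
      moreover have "Suc k \<notin> fv A" using k[of "All A"] by simp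
      ultimately show "subst_tm \<rho> (case_nat (Var k) Var i) = Var i"
        by (cases i) (auto simp: \<rho>_def)
    qed
    finally show ?thesis by simp
  qed
  ultimately show ?thesis using entails_subst[OF T A, of \<rho>] by (auto intro: entails_lift_All)
qed

lemma fresh_variable: "finite G \<Longrightarrow> \<exists>k. \<forall>B\<in>G. k \<notin> fv B"
proof -
  assume "finite G"
  hence "finite (\<Union>B\<in>G. fv B)" by (auto simp: finite_fv)
  from ex_new_if_finite[OF _ this] show ?thesis by auto
qed

text \<open>Free variables serve as Henkin witnesses, so the language is not extended. A fresh one
  always exists because \<open>G\<close> is finite; the infinite theory \<open>T\<close> is kept
  apart and is closed under substitution.\<close>

lemma henkin_step:
  assumes T: "\<And>\<sigma> A. A \<in> T \<Longrightarrow> subst_fm \<sigma> A \<in> T"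
    and G: "finite G" "\<not> entails T G Fls"
  shows "\<exists>G'. finite G' \<and> \<not> entails T G' Fls \<and> G \<subseteq> G' \<and> (\<not> entails T (insert A G) Fls \<longrightarrow>
    A \<in> G' \<and> (\<forall>B. A = Neg (All B) \<longrightarrow> (\<exists>t. Neg (inst B t) \<in> G')))"
proof (cases "\<not> entails T (insert A G) Fls")
  case cons: True
  show ?thesis
  proof (cases "\<exists>B. A = Neg (All B)")
    case True
    then obtain B where B: "A = Neg (All B)" ..
    obtain k where k: "\<forall>C\<in>insert A G. k \<notin> fv C" using fresh_variable[of "insert A G"] G by auto
    have "\<not> entails T (insert (Neg (inst B (Var k))) (insert A G)) Fls"
    proof
      assume "entails T (insert (Neg (inst B (Var k))) (insert A G)) Fls"
      hence "entails T (insert A G) (inst B (Var k))" by (rule entails_contr)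
      hence "entails T (insert A G) (All B)"
        by (rule entails_fresh[OF T, rotated -1]) (use k B in auto)
      moreover have "entails T (insert A G) (Neg (All B))" by (rule entails.hyp) (simp add: B)
      ultimately show False using cons by (blast intro: entails.mp)
    qed
    thus ?thesis using G B by (intro exI[of _ "insert (Neg (inst B (Var k))) (insert A G)"]) auto
  next
    case False
    thus ?thesis using G cons by (intro exI[of _ "insert A G"]) auto
  qed
qed (use G in blast)

lemma henkin_set:
  assumes T: "\<And>\<sigma> A. A \<in> T \<Longrightarrow> subst_fm \<sigma> A \<in> T"
    and \<phi>: "\<not> T \<turnstile> \<phi>"
  obtains H where "\<And>A. T \<turnstile> A \<Longrightarrow> A \<in> H" "\<phi> \<notin> H" "Fls \<notin> H"
    "\<And>A B. Imp A B \<in> H \<longleftrightarrow> (A \<in> H \<longrightarrow> B \<in> H)"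
    "\<And>A. All A \<in> H \<longleftrightarrow> (\<forall>t. inst A t \<in> H)"
proof -
  let ?P = "\<lambda>n G. finite G \<and> \<not> entails T G Fls \<and> Neg \<phi> \<in> G"
  let ?Q = "\<lambda>n G G'. G \<subseteq> G' \<and> (\<not> entails T (insert (dec n) G) Fls \<longrightarrow>
    dec n \<in> G' \<and> (\<forall>B. dec n = Neg (All B) \<longrightarrow> (\<exists>t. Neg (inst B t) \<in> G')))"
  have "\<exists>G. \<forall>n. ?P n (G n) \<and> ?Q n (G n) (G (Suc n))"
  proof (rule dependent_nat_choice)
    show "\<exists>G. ?P 0 G"
      using \<phi> entails_contr[of T \<phi> "{}"] entails_empty by (intro exI[of _ "{Neg \<phi>}"]) auto
    show "\<exists>G'. ?P (Suc n) G' \<and> ?Q n G G'" if "?P n G" for G n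
      using henkin_step[of T G "dec n"] T that by blast
  qed
  then obtain G where G': "\<forall>n. ?P n (G n) \<and> ?Q n (G n) (G (Suc n))" ..
  have G: "?P n (G n)" "?Q n (G n) (G (Suc n))" for n
    by (rule conjunct1[OF spec[OF G']], rule conjunct2[OF spec[OF G']])
  define H where "H = (\<Union>n. G n)"
  have mono: "m \<le> n \<Longrightarrow> G m \<subseteq> G n" for m n
    by (erule lift_Suc_mono_le[of G, rotated]) (rule conjunct1[OF G(2)])
  have GH: "G n \<subseteq> H" for n by (auto simp: H_def)
  have finite_sub: "\<exists>n. F \<subseteq> G n" if "finite F" "F \<subseteq> H" for F
    using that
  proof (induction F)
    case (insert A F)
    then obtain m n where "F \<subseteq> G m" "A \<in> G n" by (auto simp: H_def)
    with mono[of m "max m n"] mono[of n "max m n"] show ?case by (intro exI[of _ "max m n"]) auto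
  qed auto
  have cons: "\<not> entails T H Fls"
    using entails_finite[of T H Fls] finite_sub G(1) entails_mono by metis
  \<comment> \<open>The formula \<open>A\<close> is treated at some stage. Consistency with all of
    \<open>H\<close> implies consistency with that smaller stage, hence \<open>A\<close> was
    accepted and, if required, witnessed.\<close>
  have max: "A \<in> H \<and> (\<forall>B. A = Neg (All B) \<longrightarrow> (\<exists>t. Neg (inst B t) \<in> H))" if "\<not> entails T (insert A H) Fls" for A
  proof -
    obtain n where A: "dec n = A" by (metis dec_enc)
    have "\<not> entails T (insert (dec n) (G n)) Fls"
      using that entails_mono[of T "insert A (G n)" Fls "insert A H"] GH[of n] A by auto
    with G(2)[of n] GH[of "Suc n"] A show ?thesis by blast
  qed
  have closed: "A \<in> H" if "entails T H A" for A
    using max[of A] cons that entails_Imp entails.mp by blast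
  have imp: "Imp A B \<in> H \<longleftrightarrow> (A \<in> H \<longrightarrow> B \<in> H)" for A B
  proof
    show "Imp A B \<in> H \<Longrightarrow> A \<in> H \<longrightarrow> B \<in> H" by (auto intro: closed entails.mp entails.hyp)
    have "entails T (insert A H) B" if "A \<notin> H" using max[of A] that entails_Fls by blast
    moreover have "entails T (insert A H) B" if "B \<in> H" by (rule entails.hyp) (use that in simp)
    ultimately show "(A \<in> H \<longrightarrow> B \<in> H) \<Longrightarrow> Imp A B \<in> H" by (blast intro: closed entails_Imp)
  qed
  have fls: "Fls \<notin> H" using cons entails.hyp by blast
  show ?thesis
  proof (rule that[of H])
    show prv: "T \<turnstile> A \<Longrightarrow> A \<in> H" for A by (auto intro: closed entails.prv)
    show "Fls \<notin> H" by (rule fls)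
    show "\<phi> \<notin> H" using G(1)[of 0] GH[of 0] imp[of \<phi> Fls] fls by blast
    show "Imp A B \<in> H \<longleftrightarrow> (A \<in> H \<longrightarrow> B \<in> H)" for A B by (rule imp)
    show "All A \<in> H \<longleftrightarrow> (\<forall>t. inst A t \<in> H)" for A
    proof
      show "All A \<in> H \<Longrightarrow> \<forall>t. inst A t \<in> H" using prv[OF Inst] imp by blast
      assume *: "\<forall>t. inst A t \<in> H"
      show "All A \<in> H"
      proof (rule ccontr)
        assume "All A \<notin> H"
        hence "Neg (All A) \<in> H" by (simp add: imp)
        hence "\<not> entails T (insert (Neg (All A)) H) Fls" using cons by (simp add: insert_absorb)
        with max obtain t where "Neg (inst A t) \<in> H" by blast
        with * imp fls show False by blast
      qed
    qed
  qed
qed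

subsection \<open>Structures for the language of arithmetic\<close>

locale arith_structure =
  fixes zr :: 'd and sc :: "'d \<Rightarrow> 'd" and ad ml :: "'d \<Rightarrow> 'd \<Rightarrow> 'd"
begin

primrec val :: "(nat \<Rightarrow> 'd) \<Rightarrow> tm \<Rightarrow> 'd" where
  "val e (Var i) = e i"
| "val e Zero = zr"
| "val e (Succ s) = sc (val e s)"
| "val e (Add s t) = ad (val e s) (val e t)"
| "val e (Mul s t) = ml (val e s) (val e t)"

primrec holds :: "(nat \<Rightarrow> 'd) \<Rightarrow> fm \<Rightarrow> bool" where
  "holds e Fls \<longleftrightarrow> False"
| "holds e (Eq s t) \<longleftrightarrow> val e s = val e t"
| "holds e (Imp A B) \<longleftrightarrow> (holds e A \<longrightarrow> holds e B)"
| "holds e (All A) \<longleftrightarrow> (\<forall>d. holds (case_nat d e) A)"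

lemma val_subst: "val e (subst_tm \<sigma> t) = val (\<lambda>i. val e (\<sigma> i)) t"
  by (induction t) auto

lemma val_lift [simp]: "val (case_nat d e) (lift t) = val e t"
  by (simp add: lift_def val_subst)

lemma holds_subst: "holds e (subst_fm \<sigma> A) \<longleftrightarrow> holds (\<lambda>i. val e (\<sigma> i)) A"
proof (induction A arbitrary: e \<sigma>)
  case (All A)
  have "(\<lambda>i. val (case_nat d e) (up \<sigma> i)) = case_nat d (\<lambda>i. val e (\<sigma> i))" for d
    by (auto simp: up_def fun_eq_iff split: nat.split)
  with All show ?case by simp
qed (auto simp: val_subst)

lemma holds_inst: "holds e (inst A t) \<longleftrightarrow> holds (case_nat (val e t) e) A"
proof -
  have "(\<lambda>i. val e (case_nat t Var i)) = case_nat (val e t) e"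
    by (auto simp: fun_eq_iff split: nat.split)
  thus ?thesis by (simp add: inst_def holds_subst)
qed

lemma holds_inst2: "holds e (inst2 A s t) \<longleftrightarrow> holds (case_nat (val e s) (case_nat (val e t) e)) A"
proof -
  have "(\<lambda>i. val e (case_nat s (case_nat t Var) i)) = case_nat (val e s) (case_nat (val e t) e)"
    by (auto simp: fun_eq_iff split: nat.split)
  thus ?thesis by (simp add: inst2_def holds_subst)
qed

lemma soundness: "T \<turnstile> A \<Longrightarrow> (\<And>B e. B \<in> T \<Longrightarrow> holds e B) \<Longrightarrow> holds e A"
proof (induction arbitrary: e rule: proves.induct)
  case (Vac A)
  then show ?case by (simp add: lift_fm_def holds_subst)
qed (auto simp: holds_inst)

end

locale PA_model = arith_structure +
  assumes holds_PA: "B \<in> PA \<Longrightarrow> holds e B"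

lemma PA_axioms:
  "All (Neg (Eq (Succ (Var 0)) Zero)) \<in> PA"
  "All (All (Imp (Eq (Succ (Var 0)) (Succ (Var 1))) (Eq (Var 0) (Var 1)))) \<in> PA"
  "All (Eq (Add (Var 0) Zero) (Var 0)) \<in> PA"
  "All (All (Eq (Add (Var 0) (Succ (Var 1))) (Succ (Add (Var 0) (Var 1))))) \<in> PA"
  "All (Eq (Mul (Var 0) Zero) Zero) \<in> PA"
  "All (All (Eq (Mul (Var 0) (Succ (Var 1))) (Add (Mul (Var 0) (Var 1)) (Var 0)))) \<in> PA"
  "induction_ax A \<in> PA"
  unfolding PA_def by simp_all

text \<open>The numerals are distinct in the term model of PA, so its domain is countably infinite and
  can be taken to be the whole type \<open>nat\<close>.\<close>

theorem PA_countermodel: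
  assumes "\<not> PA \<turnstile> \<phi>"
  obtains zr :: nat and sc ad ml e where "PA_model zr sc ad ml" "\<not> arith_structure.holds zr sc ad ml e \<phi>"
proof -
  obtain H where prv: "\<And>A. PA \<turnstile> A \<Longrightarrow> A \<in> H" and \<phi>: "\<phi> \<notin> H" and fls: "Fls \<notin> H"
    and imp: "\<And>A B. Imp A B \<in> H \<longleftrightarrow> (A \<in> H \<longrightarrow> B \<in> H)"
    and all: "\<And>A. All A \<in> H \<longleftrightarrow> (\<forall>t. inst A t \<in> H)"
    using henkin_set[OF subst_PA assms] by blast
  define eqv where "eqv s t \<longleftrightarrow> Eq s t \<in> H" for s t
  \<comment> \<open>All laws of equality below are instances of this one, with variable 0 marking
    the occurrence to be replaced.\<close>
  have leib: "eqv s t \<Longrightarrow> inst A s \<in> H \<Longrightarrow> inst A t \<in> H" for s t A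
    using prv[OF Leib[of PA s t A]] by (simp add: imp eqv_def)
  have refl: "eqv t t" for t
    using prv[OF Refl] by (simp add: eqv_def)
  have sym: "eqv s t \<Longrightarrow> eqv t s" for s t
    using leib[of s t "Eq (Var 0) (lift s)"] refl[of s] by (simp add: eqv_def inst_def subst_lift)
  have trans: "eqv s t \<Longrightarrow> eqv t u \<Longrightarrow> eqv s u" for s t u
    using leib[of t u "Eq (lift s) (Var 0)"] by (simp add: eqv_def inst_def subst_lift)
  have Succ: "eqv s t \<Longrightarrow> eqv (Succ s) (Succ t)" for s t
    using leib[of s t "Eq (Succ (lift s)) (Succ (Var 0))"] refl[of "Succ s"]
    by (simp add: eqv_def inst_def subst_lift)
  have Add1: "eqv s t \<Longrightarrow> eqv (Add s u) (Add t u)" for s t u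
    using leib[of s t "Eq (Add (lift s) (lift u)) (Add (Var 0) (lift u))"] refl[of "Add s u"]
    by (simp add: eqv_def inst_def subst_lift)
  have Add2: "eqv s t \<Longrightarrow> eqv (Add u s) (Add u t)" for s t u
    using leib[of s t "Eq (Add (lift u) (lift s)) (Add (lift u) (Var 0))"] refl[of "Add u s"]
    by (simp add: eqv_def inst_def subst_lift)
  have Mul1: "eqv s t \<Longrightarrow> eqv (Mul s u) (Mul t u)" for s t u
    using leib[of s t "Eq (Mul (lift s) (lift u)) (Mul (Var 0) (lift u))"] refl[of "Mul s u"]
    by (simp add: eqv_def inst_def subst_lift)
  have Mul2: "eqv s t \<Longrightarrow> eqv (Mul u s) (Mul u t)" for s t u
    using leib[of s t "Eq (Mul (lift u) (lift s)) (Mul (lift u) (Var 0))"] refl[of "Mul u s"]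
    by (simp add: eqv_def inst_def subst_lift)
  have Succ_Zero: "\<not> eqv (Succ t) Zero" for t
    using prv[OF Ax[OF PA_axioms(1)]] fls by (auto simp: all imp eqv_def inst_def)
  have Succ_Succ: "eqv (Succ s) (Succ t) \<Longrightarrow> eqv s t" for s t
    using prv[OF Ax[OF PA_axioms(2)]]
    by (auto simp: all imp eqv_def inst_def subst_lift dest!: spec[of _ t] spec[of _ s])
  have num: "eqv (numeral_tm m) (numeral_tm n) \<Longrightarrow> m = n" for m n
  proof (induction m arbitrary: n)
    case 0
    thus ?case using Succ_Zero sym by (cases n) auto
  next
    case (Suc m)
    thus ?case using Succ_Zero Succ_Succ by (cases n) auto
  qed
  define cls where "cls s = {t. eqv s t}" for s
  have cls: "cls s = cls t \<longleftrightarrow> eqv s t" for s t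
    unfolding cls_def using refl sym trans by blast
  have "inj (\<lambda>n. cls (numeral_tm n))" using num by (auto simp: inj_def cls)
  hence "infinite (range cls)" by (metis infinite_UNIV_nat finite_subset finite_imageD image_subset_iff rangeI)
  moreover have "countable (range cls)"
  proof -
    have "range cls \<subseteq> range (\<lambda>n. cls (dec n))"     proof
      fix c assume "c \<in> range cls"
      then obtain s where "c = cls s" ..
      hence "c = cls (dec (enc s))" by simp
      thus "c \<in> range (\<lambda>n. cls (dec n))" by blast
    qed
    thus ?thesis by (rule countable_subset) simp
  qed
  ultimately have bij: "bij_betw (to_nat_on (range cls)) (range cls) UNIV"
    by (intro to_nat_on_infinite)
  define h where "h t = to_nat_on (range cls) (cls t)" for t
  have h: "h s = h t \<longleftrightarrow> eqv s t" for s t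
    unfolding h_def inj_on_eq_iff[OF bij_betw_imp_inj_on[OF bij] rangeI rangeI] by (rule cls)
  have "range h = to_nat_on (range cls) ` range cls" by (auto simp: h_def)
  hence "surj h" using bij_betw_imp_surj_on[OF bij] by simp
  \<comment> \<open>A choice of representatives; the operations of the model act on them, and
    well-definedness is congruence of \<open>eqv\<close>.\<close>
  then obtain g where g: "\<And>d. h (g d) = d" by (metis surj_f_inv_f)
  hence gh: "eqv (g (h t)) t" for t using h by blast
  interpret arith_structure "h Zero" "\<lambda>a. h (Succ (g a))" "\<lambda>a b. h (Add (g a) (g b))" "\<lambda>a b. h (Mul (g a) (g b))" .
  have val: "val (\<lambda>i. h (\<sigma> i)) t = h (subst_tm \<sigma> t)" for \<sigma> t
    by (induction t) (auto simp: h intro: gh Succ trans[OF Add1 Add2] trans[OF Mul1 Mul2])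
  \<comment> \<open>The truth lemma is stated for all substitutions so that the induction passes a
    quantifier: every element has the form \<open>h t\<close>.\<close>
  have holds: "holds (\<lambda>i. h (\<sigma> i)) A \<longleftrightarrow> subst_fm \<sigma> A \<in> H" for \<sigma> A
  proof (induction A arbitrary: \<sigma>)
    case Fls
    show ?case by (simp add: fls)
  next
    case (Eq s t)
    show ?case by (simp add: val h eqv_def)
  next
    case (Imp A B)
    thus ?case by (simp add: imp)
  next
    case (All A)
    have "holds (\<lambda>i. h (\<sigma> i)) (All A) \<longleftrightarrow> (\<forall>t. holds (case_nat (h t) (\<lambda>i. h (\<sigma> i))) A)"
      using g by (auto) metis
    also have "\<dots> \<longleftrightarrow> (\<forall>t. holds (\<lambda>i. h (case_nat t \<sigma> i)) A)"
    proof -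
      have "case_nat (h t) (\<lambda>i. h (\<sigma> i)) = (\<lambda>i. h (case_nat t \<sigma> i))" for t
        by (auto simp: fun_eq_iff split: nat.split)
      thus ?thesis by simp
    qed
    also have "\<dots> \<longleftrightarrow> subst_fm \<sigma> (All A) \<in> H" by (simp add: All.IH all inst_subst_up)
    finally show ?case .
  qed
  show ?thesis
  proof (rule that)
    show "PA_model (h Zero) (\<lambda>a. h (Succ (g a))) (\<lambda>a b. h (Add (g a) (g b))) (\<lambda>a b. h (Mul (g a) (g b)))"
    proof
      \<comment> \<open>Any assignment \<open>e\<close> is the image under \<open>h\<close> of the
        terms \<open>g (e i)\<close>, so the truth lemma covers it.\<close>
      show "holds e B" if "B \<in> PA" for e B
        using holds[of "\<lambda>i. g (e i)" B] prv[OF Ax[OF subst_PA[OF that]]] by (simp add: g)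
    qed
    \<comment> \<open>As \<open>\<phi>\<close> may be open, a refuting assignment is required: each
      variable denotes its own class.\<close>
    show "\<not> holds (\<lambda>i. h (Var i)) \<phi>" using holds[of Var \<phi>] \<phi> by simp
  qed
qed

section \<open>Models of Peano arithmetic\<close>

context arith_structure
begin

lemma val_cong: "(\<And>i. i \<in> fv_tm t \<Longrightarrow> e i = e' i) \<Longrightarrow> val e t = val e' t"
  by (induction t) auto

lemma holds_cong: "(\<And>i. i \<in> fv A \<Longrightarrow> e i = e' i) \<Longrightarrow> holds e A \<longleftrightarrow> holds e' A"
proof (induction A arbitrary: e e')
  case (Eq s t)
  thus ?case using val_cong[of s e e'] val_cong[of t e e'] by simp
next
  case (Imp A B)
  have "holds e A \<longleftrightarrow> holds e' A" by (rule Imp.IH(1)) (use Imp.prems in simp)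
  moreover have "holds e B \<longleftrightarrow> holds e' B" by (rule Imp.IH(2)) (use Imp.prems in simp)
  ultimately show ?case by simp
next
  case (All A)
  have "holds (case_nat d e) A \<longleftrightarrow> holds (case_nat d e') A" for d
  proof (rule All.IH)
    fix i assume "i \<in> fv A"
    thus "case_nat d e i = case_nat d e' i" using All.prems by (cases i) auto
  qed
  thus ?case by simp
qed simp

lemma holds_le_fm: "holds e (le_fm s t) \<longleftrightarrow> (\<exists>z. ad (val e s) z = val e t)"
  by (simp add: le_fm_def)

lemma holds_lt_fm: "holds e (lt_fm s t) \<longleftrightarrow> (\<exists>z. ad (sc (val e s)) z = val e t)"
  by (simp add: lt_fm_def holds_le_fm)

definition beta :: "'d \<Rightarrow> 'd \<Rightarrow> 'd \<Rightarrow> 'd \<Rightarrow> bool" where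
  "beta a b i y \<longleftrightarrow> (\<exists>z. ad (sc y) z = sc (ml (sc i) b)) \<and> (\<exists>q. a = ad (ml q (sc (ml (sc i) b))) y)"

lemma holds_beta_fm: "holds e (beta_fm a b i y) \<longleftrightarrow> beta (val e a) (val e b) (val e i) (val e y)"
  by (simp add: beta_fm_def beta_def holds_lt_fm)

definition power_of_2 :: "'d \<Rightarrow> 'd \<Rightarrow> bool" where
  "power_of_2 m y \<longleftrightarrow> (\<exists>a b. beta a b zr (sc zr) \<and>
     (\<forall>i. (\<exists>z. ad (sc i) z = m) \<longrightarrow> (\<exists>v. beta a b i v \<and> beta a b (sc i) (ad v v))) \<and> beta a b m y)"

lemma holds_pow2_fm: "holds e (pow2_fm m y) \<longleftrightarrow> power_of_2 (val e m) (val e y)"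
  by (simp add: pow2_fm_def power_of_2_def holds_beta_fm holds_lt_fm numeral_2_eq_2 numeral_3_eq_3)
    blast

lemma holds_len_fm: "holds e (len_fm p l) \<longleftrightarrow> (\<exists>y. power_of_2 (val e l) y \<and>
    (\<exists>z. ad y z = sc (val e p)) \<and> (\<exists>z. ad (sc (sc (val e p))) z = ad y y))"
  by (simp add: len_fm_def holds_pow2_fm holds_le_fm holds_lt_fm)

lemma holds_prefix_fm: "holds e (prefix_fm p q) \<longleftrightarrow> (\<exists>m y r. power_of_2 m y \<and>
    (\<exists>z. ad (sc r) z = y) \<and> sc (val e q) = ad (ml (sc (val e p)) y) r)"
  by (simp add: prefix_fm_def holds_pow2_fm holds_lt_fm numeral_2_eq_2)

primrec num :: "nat \<Rightarrow> 'd" where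
  "num 0 = zr"
| "num (Suc n) = sc (num n)"

lemma val_numeral_tm [simp]: "val e (numeral_tm n) = num n"
  by (induction n) auto

end

text \<open>Read off from the meaning of \<open>len_fm\<close> in the standard model; its
  arithmetical form can be transferred to numerals of other models.\<close>

lemma length_inv_code_iff: "j = length (inv code k) \<longleftrightarrow> 2 ^ j \<le> Suc k \<and> Suc k < 2 ^ j + 2 ^ j"
  using sat_len[of "\<lambda>_. 0" "numeral_tm k" "numeral_tm j"] by (simp add: len_fm_def)

lemma prefix_code_iff: "prefix s t \<longleftrightarrow> (\<exists>m r. r < 2 ^ m \<and> Suc (code t) = Suc (code s) * 2 ^ m + r)"
  using sat_prefix[of "\<lambda>_. 0" "numeral_tm (code s)" "numeral_tm (code t)"]
  by (simp add: prefix_fm_def numeral_2_eq_2 del: power_Suc mult_Suc)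

context PA_model
begin

section \<open>Elementary arithmetic in an arbitrary model of PA\<close>

lemma sc_neq_zr [simp]: "sc x \<noteq> zr" "zr \<noteq> sc x"
  using holds_PA[OF PA_axioms(1), of "\<lambda>_. zr"] by (auto dest: sym)

lemma sc_eq_iff [simp]: "sc x = sc y \<longleftrightarrow> x = y"
  using holds_PA[OF PA_axioms(2), of "\<lambda>_. zr"] by auto

lemma ad_right [simp]: "ad x zr = x" "ad x (sc y) = sc (ad x y)"
  using holds_PA[OF PA_axioms(3), of "\<lambda>_. zr"] holds_PA[OF PA_axioms(4), of "\<lambda>_. zr"] by auto

lemma ml_right [simp]: "ml x zr = zr" "ml x (sc y) = ad (ml x y) x"
  using holds_PA[OF PA_axioms(5), of "\<lambda>_. zr"] holds_PA[OF PA_axioms(6), of "\<lambda>_. zr"] by auto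

text \<open>Induction is available only for sets definable with parameters from \<open>e\<close>, so
  each law below is first written as a formula.\<close>

lemma definable_induct:
  assumes "holds (case_nat zr e) A"
    and "\<And>d. holds (case_nat d e) A \<Longrightarrow> holds (case_nat (sc d) e) A"
  shows "holds (case_nat d e) A"
proof -
  have "(\<lambda>i. val (case_nat d e) (case_nat (Succ (Var 0)) (\<lambda>i. Var (Suc i)) i)) = case_nat (sc d) e" for d
    by (auto simp: fun_eq_iff split: nat.split)
  thus ?thesis
    using holds_PA[OF PA_axioms(7), of e A] assms by (simp add: induction_ax_def holds_inst holds_subst)
qed

lemma zr_or_sc: "x = zr \<or> (\<exists>y. x = sc y)"
  using definable_induct[of "\<lambda>_. zr" "Imp (Neg (Eq (Var 0) Zero)) (Ex (Eq (Var 1) (Succ (Var 0))))" x]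
  by auto

lemma ad_zr_left [simp]: "ad zr x = x"
  using definable_induct[of "\<lambda>_. zr" "Eq (Add Zero (Var 0)) (Var 0)" x] by simp

lemma ad_sc_left [simp]: "ad (sc x) y = sc (ad x y)"
  using definable_induct[of "\<lambda>_. x" "Eq (Add (Succ (Var 1)) (Var 0)) (Succ (Add (Var 1) (Var 0)))" y]
  by simp

lemma ad_assoc: "ad (ad x y) z = ad x (ad y z)"
  using definable_induct[of "case_nat x (\<lambda>_. y)"
      "Eq (Add (Add (Var 1) (Var 2)) (Var 0)) (Add (Var 1) (Add (Var 2) (Var 0)))" z]
  by (simp add: numeral_2_eq_2)

lemma ad_commute: "ad x y = ad y x"
  using definable_induct[of "\<lambda>_. x" "Eq (Add (Var 1) (Var 0)) (Add (Var 0) (Var 1))" y] by simp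

lemma ad_left_commute: "ad x (ad y z) = ad y (ad x z)"
  by (metis ad_assoc ad_commute)

lemmas ad_ac = ad_assoc ad_commute ad_left_commute

lemma ad_right_cancel [simp]: "ad x z = ad y z \<longleftrightarrow> x = y"
  using definable_induct[of "case_nat x (\<lambda>_. y)"
      "Imp (Eq (Add (Var 1) (Var 0)) (Add (Var 2) (Var 0))) (Eq (Var 1) (Var 2))" z]
  by (auto simp: numeral_2_eq_2)

lemma ad_left_cancel [simp]: "ad z x = ad z y \<longleftrightarrow> x = y"
  by (simp add: ad_commute[of z])

lemma ml_zr_left [simp]: "ml zr x = zr"
  using definable_induct[of "\<lambda>_. zr" "Eq (Mul Zero (Var 0)) Zero" x] by simp

lemma ml_sc_left [simp]: "ml (sc x) y = ad (ml x y) y"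
proof -
  have "ad (ad u d) x = ad (ad u x) d" for u d by (simp add: ad_ac)
  thus ?thesis
    using definable_induct[of "\<lambda>_. x" "Eq (Mul (Succ (Var 1)) (Var 0)) (Add (Mul (Var 1) (Var 0)) (Var 0))" y]
    by simp
qed

lemma ml_distrib_right: "ml (ad x y) z = ad (ml x z) (ml y z)"
  using definable_induct[of "case_nat x (\<lambda>_. z)"
      "Eq (Mul (Add (Var 1) (Var 0)) (Var 2)) (Add (Mul (Var 1) (Var 2)) (Mul (Var 0) (Var 2)))" y]
  by (simp add: numeral_2_eq_2 ad_assoc)

text \<open>Induction on \<open>y\<close>. If \<open>y\<close> lies below \<open>x\<close> with
  difference \<open>r\<close>, then passing to the successor of \<open>y\<close> depends on whether
  \<open>r\<close> is zero or a successor.\<close>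

lemma total: "(\<exists>r. ad x r = y) \<or> (\<exists>r. ad y r = x)"
proof -
  have step: "(\<exists>r. ad x r = sc d) \<or> (\<exists>r. ad (sc d) r = x)" if "(\<exists>r. ad x r = d) \<or> (\<exists>r. ad d r = x)" for d
    using that
  proof
    assume "\<exists>r. ad x r = d"
    thus ?thesis by (metis ad_right(2))
  next
    assume "\<exists>r. ad d r = x"
    then obtain r where r: "ad d r = x" ..
    show ?thesis
    proof (cases "r = zr")
      case True
      thus ?thesis using r by (metis ad_right)
    next
      case False
      thus ?thesis using r zr_or_sc[of r] by auto
    qed
  qed
  have "(\<exists>r. ad x r = zr) \<or> (\<exists>r. ad zr r = x)" by simp
  with step show ?thesis
    using definable_induct[of "\<lambda>_. x" "Imp (Neg (Ex (Eq (Add (Var 2) (Var 0)) (Var 1))))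
      (Ex (Eq (Add (Var 1) (Var 0)) (Var 2)))" y]
    by (simp add: numeral_2_eq_2 del: ad_zr_left) blast
qed

lemma ad_sc_neq: "ad x (sc y) \<noteq> x"
  using ad_left_cancel[of x "sc y" zr] by simp

text \<open>Were the quotients different, cancelling would leave on the right a full copy of
  \<open>d\<close>, which exceeds \<open>y\<close>; then \<open>y\<close> would equal
  \<open>y\<close> plus a successor.\<close>

lemma remainder_unique_aux:
  assumes "ad (sc y) z = d" and "ad (ml q d) y = ad (ml (ad q r) d) y'"
  shows "y = y'"
proof (cases "r = zr")
  case True
  thus ?thesis using assms(2) by simp
next
  case False
  then obtain s where "r = sc s" using zr_or_sc by blast
  hence "ad (ml q d) y = ad (ml q d) (ad (ad (ml s d) d) y')"
    using assms(2) by (simp add: ml_distrib_right ad_assoc)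
  hence "y = ad (ad (ml s d) d) y'" by simp
  also have "\<dots> = ad y (sc (ad z (ad (ml s d) y')))"
    unfolding arg_cong[OF assms(1)[symmetric], of "\<lambda>u. ad (ad (ml s d) u) y'"] by (simp add: ad_ac)
  finally show ?thesis using ad_sc_neq by metis
qed

lemma remainder_unique:
  assumes "ad (sc y) z = d" "ad (sc y') z' = d" "ad (ml q d) y = ad (ml q' d) y'"
  shows "y = y'"
  using total[of q q'] remainder_unique_aux[of y z d q _ y'] remainder_unique_aux[of y' z' d q' _ y] assms
  by metis

text \<open>The codes \<open>a\<close> and \<open>b\<close> may be nonstandard, so uniqueness has to
  come from the arithmetic of the model and not from \<open>bt\<close>.\<close>

lemma beta_unique: "beta a b i y \<Longrightarrow> beta a b i y' \<Longrightarrow> y = y'"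
  unfolding beta_def using remainder_unique by metis

section \<open>The numerals as an initial segment of the model\<close>

lemma num_eq_iff [simp]: "num m = num n \<longleftrightarrow> m = n"
proof (induction m arbitrary: n)
  case 0
  show ?case by (cases n) auto
next
  case (Suc m)
  thus ?case by (cases n) auto
qed

lemma ad_num [simp]: "ad (num m) (num n) = num (m + n)"
  by (induction n) auto

lemma ml_num [simp]: "ml (num m) (num n) = num (m * n)"
  by (induction n) (auto simp: add.commute)

lemma sc_num: "sc (num n) = num (Suc n)"
  by simp

text \<open>Successors are stripped from \<open>z\<close> one at a time; a summand of a numeral runs
  out after at most \<open>n\<close> steps. This excludes nonstandard elements below a
  numeral.\<close>

lemma ad_eq_num: "ad x z = num n \<Longrightarrow> \<exists>k\<le>n. x = num k \<and> z = num (n - k)"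
proof (induction n arbitrary: z)
  case 0
  hence "z = zr" using zr_or_sc[of z] by (metis ad_right(2) num.simps(1) sc_neq_zr(1))
  thus ?case using 0 by simp
next
  case (Suc n)
  from zr_or_sc[of z] show ?case
  proof
    assume "z = zr"
    thus ?case using Suc.prems by (intro exI[of _ "Suc n"]) simp
  next
    assume "\<exists>y. z = sc y"
    then obtain y where y: "z = sc y" ..
    with Suc obtain k where "k \<le> n" "x = num k" "y = num (n - k)" by auto
    thus ?case by (intro exI[of _ k]) (simp add: y Suc_diff_le)
  qed
qed

lemma le_num_iff: "(\<exists>z. ad (num m) z = num n) \<longleftrightarrow> m \<le> n"
proof
  assume "\<exists>z. ad (num m) z = num n"
  thus "m \<le> n" using ad_eq_num by fastforce
next
  assume "m \<le> n"
  thus "\<exists>z. ad (num m) z = num n" by (intro exI[of _ "num (n - m)"]) simp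
qed

lemma less_num_iff: "(\<exists>z. ad (sc x) z = num n) \<longleftrightarrow> (\<exists>k<n. x = num k)"
proof
  assume "\<exists>z. ad (sc x) z = num n"
  then obtain k where k: "k \<le> n" "sc x = num k" using ad_eq_num by blast
  thus "\<exists>k<n. x = num k" by (cases k) auto
next
  assume "\<exists>k<n. x = num k"
  then obtain k where "k < n" "x = num k" by blast
  thus "\<exists>z. ad (sc x) z = num n" using le_num_iff[of "Suc k" n] by simp
qed

lemma beta_num: "beta (num a) (num b) (num i) (num (bt a b i))"
proof -
  let ?d = "Suc (Suc i * b)"
  have d: "sc (ml (sc (num i)) (num b)) = num ?d" by (simp only: sc_num ml_num)
  have "num a = ad (ml (num (a div ?d)) (num ?d)) (num (a mod ?d))"
    by (simp only: ml_num ad_num div_mult_mod_eq)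
  moreover have "\<exists>z. ad (sc (num (a mod ?d))) z = num ?d"
    unfolding less_num_iff by (intro exI[of _ "a mod ?d"]) simp
  ultimately show ?thesis unfolding beta_def d bt_def by blast
qed

text \<open>A witnessing sequence may have a nonstandard code, but ordinary induction determines its
  entries up to the standard position \<open>j\<close>. Conversely, a real code of the sequence
  works in the model.\<close>

lemma power_of_2_num_iff: "power_of_2 (num j) y \<longleftrightarrow> y = num (2 ^ j)"
proof
  assume "power_of_2 (num j) y"
  then obtain a b where 0: "beta a b zr (sc zr)" and j: "beta a b (num j) y"
    and step: "\<And>i. i < j \<Longrightarrow> \<exists>v. beta a b (num i) v \<and> beta a b (sc (num i)) (ad v v)"
    unfolding power_of_2_def less_num_iff by blast
  have "i \<le> j \<Longrightarrow> beta a b (num i) (num (2 ^ i))" for i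
  proof (induction i)
    case (Suc i)
    then obtain v where v: "beta a b (num i) v" "beta a b (num (Suc i)) (ad v v)" using step[of i] by auto
    have "v = num (2 ^ i)" using v(1) Suc by (auto intro: beta_unique)
    with v(2) show ?case by (simp add: mult_2)
  qed (use 0 in simp)
  with j show "y = num (2 ^ j)" by (blast intro: beta_unique)
next
  assume y: "y = num (2 ^ j)"
  obtain a b where ab: "\<forall>i\<le>j. bt a b i = 2 ^ i" using beta_ex[of j "\<lambda>i. 2 ^ i"] by blast
  have *: "beta (num a) (num b) (num i) (num (2 ^ i))" if "i \<le> j" for i
    using beta_num[of a b i] ab that by simp
  show "power_of_2 (num j) y"
    unfolding power_of_2_def less_num_iff
  proof (rule exI[of _ "num a"], rule exI[of _ "num b"], intro conjI allI impI)
    show "beta (num a) (num b) zr (sc zr)" using *[of 0] by simp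
    show "beta (num a) (num b) (num j) y" using *[of j] y by simp
    fix i assume "\<exists>k<j. i = num k"
    then obtain k where k: "k < j" "i = num k" by blast
    show "\<exists>v. beta (num a) (num b) i v \<and> beta (num a) (num b) (sc i) (ad v v)"
      using *[of k] *[of "Suc k"] k by (intro exI[of _ "num (2 ^ k)"]) (simp add: mult_2)
  qed
qed

text \<open>Standard length bounds the code by the numeral of \<open>2 ^ (j + 1)\<close>, so the
  element is itself a numeral and codes a real string.\<close>

lemma holds_len_fm_num:
  assumes "val e l = num j" "holds e (len_fm p l)"
  obtains s where "val e p = num (code s)" "j = length s"
proof -
  from assms have le: "\<exists>z. ad (num (2 ^ j)) z = sc (val e p)"
    and less: "\<exists>z. ad (sc (sc (val e p))) z = num (2 ^ j + 2 ^ j)"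
    unfolding holds_len_fm by (auto simp: power_of_2_num_iff)
  from less obtain k where k: "k < 2 ^ j + 2 ^ j" "sc (val e p) = num k"
    unfolding less_num_iff by blast
  with le have "2 ^ j \<le> k" by (simp add: le_num_iff)
  then obtain i where i: "k = Suc i" by (cases k) auto
  with k \<open>2 ^ j \<le> k\<close> have "j = length (inv code i)" by (simp add: length_inv_code_iff)
  moreover have "code (inv code i) = i" using bij_code by (simp add: bij_is_surj surj_f_inv_f)
  ultimately show thesis using that[of "inv code i"] k(2) i by simp
qed

text \<open>The existential witnesses are standard numbers, and their equations hold between
  numerals in every model of PA.\<close>

lemma holds_prefix_fm_num:
  assumes "val e p = num (code s)" "val e q = num (code t)" "prefix s t"
  shows "holds e (prefix_fm p q)"
proof -
  obtain m r where mr: "r < 2 ^ m" "Suc (code t) = Suc (code s) * 2 ^ m + r"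
    using assms(3) unfolding prefix_code_iff by blast
  show ?thesis unfolding holds_prefix_fm assms
    by (rule exI[of _ "num m"], rule exI[of _ "num (2 ^ m)"], rule exI[of _ "num r"])
      (simp add: mr power_of_2_num_iff le_num_iff Suc_le_eq sc_num del: num.simps mult_Suc)
qed

text \<open>A model of PA has its own version of the represented machine. On standard programs and
  outputs it is still a prefix-free function, but it may extend the real machine.\<close>

definition outputs :: "fm \<Rightarrow> bool list \<Rightarrow> bool list \<Rightarrow> bool" where
  "outputs \<Psi> p x \<longleftrightarrow> holds (case_nat (num (code p)) (case_nat (num (code x)) (\<lambda>_. zr))) \<Psi>"

lemma outputs_iff:
  assumes "represents_prefix_machine \<Psi> U"
  shows "holds (case_nat (num (code p)) (case_nat (num (code x)) e)) \<Psi> \<longleftrightarrow> outputs \<Psi> p x"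
  unfolding outputs_def
proof (rule holds_cong)
  fix i assume "i \<in> fv \<Psi>"
  hence "i = 0 \<or> i = 1" using assms by (auto simp: represents_prefix_machine_def)
  thus "case_nat (num (code p)) (case_nat (num (code x)) e) i =
      case_nat (num (code p)) (case_nat (num (code x)) (\<lambda>_. zr)) i" by auto
qed

lemma holds_theorem: "PA \<turnstile> A \<Longrightarrow> holds e A"
  using soundness holds_PA by blast

lemma outputs_functional:
  assumes \<Psi>: "represents_prefix_machine \<Psi> U" and "outputs \<Psi> p x" "outputs \<Psi> p y"
  shows "x = y"
proof -
  have "holds (\<lambda>_. zr) (All (All (All
       (Imp (inst2 \<Psi> (Var 2) (Var 1)) (Imp (inst2 \<Psi> (Var 2) (Var 0)) (Eq (Var 1) (Var 0)))))))"
    using \<Psi> by (intro holds_theorem) (simp add: represents_prefix_machine_def)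
  from this[unfolded holds.simps, THEN spec[of _ "num (code p)"], THEN spec[of _ "num (code x)"],
      THEN spec[of _ "num (code y)"]]
  have "num (code x) = num (code y)"
    using assms(2,3) by (simp add: holds_inst2 outputs_iff[OF \<Psi>] numeral_2_eq_2)
  thus ?thesis using bij_code by (simp add: bij_is_inj inj_eq)
qed

lemma outputs_prefix_free:
  assumes \<Psi>: "represents_prefix_machine \<Psi> U" and "outputs \<Psi> p x" "outputs \<Psi> q y" "prefix p q"
  shows "p = q"
proof -
  have "holds (\<lambda>_. zr) (All (All (All (All
       (Imp (inst2 \<Psi> (Var 3) (Var 1)) (Imp (inst2 \<Psi> (Var 2) (Var 0))
         (Imp (prefix_fm (Var 3) (Var 2)) (Eq (Var 3) (Var 2)))))))))"
    using \<Psi> by (intro holds_theorem) (simp add: represents_prefix_machine_def)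
  from this[unfolded holds.simps, THEN spec[of _ "num (code p)"], THEN spec[of _ "num (code q)"],
      THEN spec[of _ "num (code x)"], THEN spec[of _ "num (code y)"]]
  have "num (code p) = num (code q)"
    using assms(2,3) holds_prefix_fm_num[OF _ _ assms(4)]
    by (simp add: holds_inst2 outputs_iff[OF \<Psi>] numeral_2_eq_2 numeral_3_eq_3)
  thus ?thesis using bij_code by (simp add: bij_is_inj inj_eq)
qed

text \<open>A program refuting the bound is shorter than a numeral, hence standard.\<close>

lemma not_holds_K_ge_fm:
  assumes \<Psi>: "represents_prefix_machine \<Psi> U"
    and "\<not> holds e (K_ge_fm \<Psi> (numeral_tm (code x)) (numeral_tm n) (numeral_tm c))"
  shows "\<exists>p. outputs \<Psi> p x \<and> length p + c < n"
proof -
  from assms(2) obtain p l where out: "holds (case_nat p (case_nat (num (code x)) (case_nat l (case_nat p e)))) \<Psi>"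
    and len: "holds (case_nat l (case_nat p e)) (len_fm (Var 1) (Var 0))"
    and less: "\<nexists>z. ad (num n) z = ad l (num c)"
    unfolding K_ge_fm_def by (auto simp: holds_inst2 holds_le_fm)
  \<comment> \<open>By linearity the failed inequality turns around, which makes \<open>l\<close> a
    summand of the numeral \<open>num n\<close>.\<close>
  from less total[of "num n" "ad l (num c)"] obtain r where "ad (ad l (num c)) r = num n" by blast
  hence "ad l (ad (num c) r) = num n" by (simp add: ad_assoc)
  from ad_eq_num[OF this] obtain j where j: "l = num j" by blast
  with less have "j + c < n" by (simp add: le_num_iff)
  moreover obtain s where "p = num (code s)" "j = length s"
    using holds_len_fm_num[OF _ len, of j] j by auto
  ultimately show ?thesis using out outputs_iff[OF \<Psi>] by auto
qed

end

section \<open>Cylinders and the Kraft inequality\<close>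

lemma length_seq_prefix [simp]: "length (seq_prefix Y n) = n"
  by (simp add: seq_prefix_def)

lemma take_seq_prefix: "m \<le> n \<Longrightarrow> take m (seq_prefix Y n) = seq_prefix Y m"
  by (simp add: seq_prefix_def take_map take_upt)

lemma prefix_seq_prefix: "m \<le> n \<Longrightarrow> prefix (seq_prefix Y m) (seq_prefix Y n)"
  by (metis take_is_prefix take_seq_prefix)

lemma cylinder_antimono: "prefix t s \<Longrightarrow> cylinder s \<subseteq> cylinder t"
proof
  fix Y assume "prefix t s" "Y \<in> cylinder s"
  hence "seq_prefix Y (length s) = s" by (simp add: cylinder_def)
  moreover have "t = take (length t) s" "length t \<le> length s"
    using \<open>prefix t s\<close> by (auto simp: prefix_def)
  ultimately show "Y \<in> cylinder t" by (simp add: cylinder_def) (metis take_seq_prefix)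
qed

lemma cylinder_overlap:
  assumes "Y \<in> cylinder s" "Y \<in> cylinder t"
  shows "prefix s t \<or> prefix t s"
  using assms prefix_seq_prefix[of "length s" "length t" Y] prefix_seq_prefix[of "length t" "length s" Y]
  by (cases "length s \<le> length t") (auto simp: cylinder_def)

lemma prob_space_coin_measure: "prob_space coin_measure"
  unfolding coin_measure_def by (intro prob_space_PiM prob_space_measure_pmf)

lemma emeasure_cylinder: "emeasure coin_measure (cylinder s) = ennreal ((1 / 2) ^ length s)"
proof -
  have "cylinder s = {Y \<in> space coin_measure. \<forall>i\<in>{..<length s}. Y i \<in> {s ! i}}"
  proof -
    have "space coin_measure = UNIV" by (simp add: coin_measure_def space_PiM)
    moreover have "Y \<in> cylinder s \<longleftrightarrow> (\<forall>i<length s. Y i = s ! i)" for Y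
      unfolding cylinder_def mem_Collect_eq list_eq_iff_nth_eq by (simp add: seq_prefix_def)
    ultimately show ?thesis by auto
  qed
  hence "emeasure coin_measure (cylinder s) =
      (\<Prod>i<length s. emeasure (measure_pmf (bernoulli_pmf (1 / 2))) {s ! i})"
    unfolding coin_measure_def
    by (simp only:) (rule product_prob_space.emeasure_PiM_Collect[OF
        product_prob_spaceI[OF prob_space_measure_pmf]]; simp)
  also have "\<dots> = (\<Prod>i<length s. ennreal (1 / 2))"
  proof -
    have "emeasure (measure_pmf (bernoulli_pmf (1 / 2))) {b} = ennreal (1 / 2)" for b :: bool
      by (cases b) (simp_all add: emeasure_pmf_single)
    thus ?thesis by (simp only:)
  qed
  also have "\<dots> = ennreal ((1 / 2) ^ length s)" by (simp only: prod_constant card_lessThan ennreal_power)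
  finally show ?thesis .
qed

text \<open>A set outside the sigma-algebra would have \<open>emeasure\<close> zero, but a cylinder
  has positive measure.\<close>

lemma cylinder_in_sets [measurable]: "cylinder s \<in> sets coin_measure"
proof (rule ccontr)
  assume "cylinder s \<notin> sets coin_measure"
  from emeasure_notin_sets[OF this] show False by (simp add: emeasure_cylinder)
qed

text \<open>A program at least \<open>c\<close> bits shorter than its output has a cylinder at least
  \<open>2 ^ c\<close> times larger than that of the output. The cylinders of programs are disjoint,
  so they have total measure at most 1. A relation \<open>R\<close> replaces the machine so that the
  programs of a model can be used.\<close>

lemma kraft_cover:
  fixes R :: "bool list \<Rightarrow> bool list \<Rightarrow> bool"
  assumes functional: "\<And>p x y. R p x \<Longrightarrow> R p y \<Longrightarrow> x = y"
    and prefix_free: "\<And>p q x y. R p x \<Longrightarrow> R q y \<Longrightarrow> prefix p q \<Longrightarrow> p = q"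
    and cover: "\<And>Y. Y \<in> V \<Longrightarrow> \<exists>p x. R p x \<and> length p + c \<le> length x \<and> Y \<in> cylinder x"
  shows "emeasure coin_measure V \<le> ennreal ((1 / 2) ^ c)"
proof -
  let ?M = coin_measure
  \<comment> \<open>Programs are indexed by their codes to sum over \<open>nat\<close>; indices
    without a suitable output contribute empty sets.\<close>
  define P where "P n x \<longleftrightarrow> R (inv code n) x \<and> length (inv code n) + c \<le> length x" for n x
  define A where "A n = (\<Union>x\<in>{x. P n x}. cylinder x)" for n
  define B where "B n = (if \<exists>x. P n x then cylinder (inv code n) else {})" for n
  have sets: "A n \<in> sets ?M" "B n \<in> sets ?M" and AB: "emeasure ?M (A n) \<le> ennreal ((1 / 2) ^ c) * emeasure ?M (B n)" for n
  proof -
    show "B n \<in> sets ?M" by (simp add: B_def)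
    show "A n \<in> sets ?M" "emeasure ?M (A n) \<le> ennreal ((1 / 2) ^ c) * emeasure ?M (B n)"
    proof (atomize (full), cases "\<exists>x. P n x")
      case True
      then obtain x where x: "P n x" ..
      have "{x. P n x} = {x}" using x functional by (auto simp: P_def)
      hence A: "A n = cylinder x" by (simp add: A_def)
      have "(1 / 2) ^ length x \<le> (1 / 2 :: real) ^ (c + length (inv code n))"
        using x by (intro power_decreasing) (auto simp: P_def)
      hence "ennreal ((1 / 2) ^ length x) \<le> ennreal ((1 / 2) ^ c) * ennreal ((1 / 2) ^ length (inv code n))"
        by (simp add: power_add flip: ennreal_mult del: power_one_over)
      moreover have "B n = cylinder (inv code n)" using x by (auto simp: B_def)
      ultimately show "A n \<in> sets ?M \<and> emeasure ?M (A n) \<le> ennreal ((1 / 2) ^ c) * emeasure ?M (B n)"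
        by (simp only: A emeasure_cylinder cylinder_in_sets simp_thms)
    next
      case False
      hence "A n = {}" by (auto simp: A_def)
      thus "A n \<in> sets ?M \<and> emeasure ?M (A n) \<le> ennreal ((1 / 2) ^ c) * emeasure ?M (B n)" by simp
    qed
  qed
  have "disjoint_family B"
    unfolding disjoint_family_on_def
  proof (intro ballI impI, rule ccontr)
    fix m n :: nat assume "m \<noteq> n" "B m \<inter> B n \<noteq> {}"
    then obtain Y where "Y \<in> B m" "Y \<in> B n" by blast
    then obtain x y where "P m x" "P n y" "Y \<in> cylinder (inv code m)" "Y \<in> cylinder (inv code n)"
      by (auto simp: B_def split: if_splits)
    with cylinder_overlap prefix_free have "inv code m = inv code n" unfolding P_def by metis
    hence "m = n" using bij_code by (metis bij_inv_eq_iff)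
    with \<open>m \<noteq> n\<close> show False ..
  qed
  have "V \<subseteq> (\<Union>n. A n)"
  proof
    fix Y assume "Y \<in> V"
    from cover[OF this] obtain p x where px: "R p x" "length p + c \<le> length x" "Y \<in> cylinder x" by blast
    hence "Y \<in> A (code p)" by (auto simp: A_def P_def)
    thus "Y \<in> (\<Union>n. A n)" by blast
  qed
  \<comment> \<open>Monotonicity asks for measurability of the larger set only, so \<open>V\<close>
    may be arbitrary.\<close>
  hence "emeasure ?M V \<le> emeasure ?M (\<Union>n. A n)" using sets(1) by (intro emeasure_mono) auto
  also have "\<dots> \<le> (\<Sum>n. emeasure ?M (A n))" using sets(1) by (intro emeasure_subadditive_countably) auto
  also have "\<dots> \<le> (\<Sum>n. ennreal ((1 / 2) ^ c) * emeasure ?M (B n))" using AB by (intro suminf_le) auto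
  also have "\<dots> = ennreal ((1 / 2) ^ c) * (\<Sum>n. emeasure ?M (B n))" by (rule ennreal_suminf_cmult)
  also have "(\<Sum>n. emeasure ?M (B n)) = emeasure ?M (\<Union>n. B n)"
    using sets(2) \<open>disjoint_family B\<close> by (intro suminf_emeasure) auto
  also have "ennreal ((1 / 2) ^ c) * \<dots> \<le> ennreal ((1 / 2) ^ c) * 1"
    by (intro mult_left_mono prob_space.emeasure_le_1[OF prob_space_coin_measure]) simp
  finally show ?thesis by simp
qed

section \<open>Compactness of proofs\<close>

lemma proves_mono: "S \<turnstile> A \<Longrightarrow> S \<subseteq> T \<Longrightarrow> T \<turnstile> A"
proof (induction rule: proves.induct)
  case (MP A B)
  thus ?case by (blast intro: proves.MP)
qed (auto intro: proves.intros(1-9) Gen)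

text \<open>Along a chain, the stages used for the two premises of modus ponens are merged at their
  maximum.\<close>

lemma proves_UN_mono:
  fixes T :: "nat \<Rightarrow> fm set"
  assumes "mono T" "(\<Union>n. T n) \<turnstile> A"
  shows "\<exists>n. T n \<turnstile> A"
  using assms(2)
proof (induction rule: proves.induct)
  case (MP A B)
  then obtain m n where "T m \<turnstile> Imp A B" "T n \<turnstile> A" by blast
  with monoD[OF assms(1), of m "max m n"] monoD[OF assms(1), of n "max m n"]
  have "T (max m n) \<turnstile> Imp A B" "T (max m n) \<turnstile> A" by (auto intro: proves_mono)
  thus ?case by (blast intro: proves.MP)
next
  case (Ax A)
  thus ?case by (auto intro: proves.Ax)
next
  case (Gen A)
  thus ?case by (auto intro: proves.Gen)
qed (rule exI, rule proves.intros(2-9))+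

lemma MLR_subset_UN: "MLR \<Psi> c X \<subseteq> (\<Union>n. MLR_prefix \<Psi> c (seq_prefix X n))"
proof
  fix A assume "A \<in> MLR \<Psi> c X"
  then consider "A \<in> PA"
    | n where "A = K_ge_fm \<Psi> (numeral_tm (code (seq_prefix X n))) (numeral_tm n) (numeral_tm c)"
    unfolding MLR_def by blast
  thus "A \<in> (\<Union>n. MLR_prefix \<Psi> c (seq_prefix X n))"
  proof cases
    case 1
    thus ?thesis by (simp add: MLR_prefix_def)
  next
    case (2 n)
    hence "A \<in> MLR_prefix \<Psi> c (seq_prefix X n)"
      unfolding MLR_prefix_def by (intro UnI2 CollectI exI[of _ "seq_prefix X n"]) simp
    thus ?thesis by blast
  qed
qed

lemma mono_MLR_prefix: "mono (\<lambda>n. MLR_prefix \<Psi> c (seq_prefix X n))"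
  unfolding MLR_prefix_def mono_def
  using prefix_order.trans prefix_seq_prefix by blast

section \<open>The Martin-Loef test and the conclusion\<close>

theorem theorem14:
  fixes U :: "bool list \<Rightarrow> bool list option"
    and \<Psi> \<phi> :: fm
    and X :: "nat \<Rightarrow> bool"
  assumes "optimal_prefix_machine U"
    and "represents_prefix_machine \<Psi> U"
    and "martin_loef_random X"
    and "\<And>c. MLR \<Psi> c X \<turnstile> \<phi>"
  shows "PA \<turnstile> \<phi>"
proof (rule ccontr)
  assume "\<not> PA \<turnstile> \<phi>"
  then obtain zr :: nat and sc ad ml e where "PA_model zr sc ad ml"
    and \<phi>: "\<not> arith_structure.holds zr sc ad ml e \<phi>"
    by (rule PA_countermodel)
  then interpret PA_model zr sc ad ml by simp
  \<comment> \<open>If PA proved \<open>\<phi>\<close>, these sets would contain all strings; that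
    they are small depends on the countermodel.\<close>
  let ?W = "\<lambda>c. {s. MLR_prefix \<Psi> c s \<turnstile> \<phi>}"
  have "emeasure coin_measure (\<Union>s\<in>?W c. cylinder s) \<le> ennreal ((1 / 2) ^ c)" for c
  proof (rule kraft_cover[where R = "outputs \<Psi>"])
    fix Y assume "Y \<in> (\<Union>s\<in>?W c. cylinder s)"
    then obtain s where s: "MLR_prefix \<Psi> c s \<turnstile> \<phi>" "Y \<in> cylinder s" by blast
    \<comment> \<open>The axioms in PA hold in the model, so the failing one is a bound on the
      complexity of some prefix of \<open>s\<close>.\<close>
    from soundness[OF s(1)] \<phi> obtain B e' where "B \<in> MLR_prefix \<Psi> c s" "\<not> holds e' B" by blast
    then obtain t where t: "prefix t s"
      "\<not> holds e' (K_ge_fm \<Psi> (numeral_tm (code t)) (numeral_tm (length t)) (numeral_tm c))"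
      using holds_PA unfolding MLR_prefix_def by blast
    from not_holds_K_ge_fm[OF assms(2) t(2)] obtain p where "outputs \<Psi> p t" "length p + c < length t"
      by blast
    with s(2) cylinder_antimono[OF t(1)]
    show "\<exists>p x. outputs \<Psi> p x \<and> length p + c \<le> length x \<and> Y \<in> cylinder x"
      by (intro exI[of _ p] exI[of _ t]) auto
  qed (fact outputs_functional[OF assms(2)] outputs_prefix_free[OF assms(2)])+
  with uniformly_re_MLR_prefix have "martin_loef_test ?W"
    by (simp add: martin_loef_test_def)
  moreover have "X \<in> (\<Union>s\<in>?W c. cylinder s)" for c
  proof -
    obtain n where "MLR_prefix \<Psi> c (seq_prefix X n) \<turnstile> \<phi>"
      using proves_UN_mono[OF mono_MLR_prefix proves_mono[OF assms(4) MLR_subset_UN]] by blast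
    moreover have "X \<in> cylinder (seq_prefix X n)" by (simp add: cylinder_def)
    ultimately show ?thesis by blast
  qed
  ultimately show False using assms(3) unfolding martin_loef_random_def by blast
qed

end
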